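(* Let $\Lambda$ be a countable set and let $Q=(q(x,y))_{x,y\in\Lambda\cup\{0\}}$ be the rate matrix of a non-exploding continuous-time Markov jump process $Z$ on $\Lambda\cup\{0\}$, irreducible on $\Lambda$, for which $0$ is absorbing and absorption is certain; here $q(x,x)=-\sum_{y\neq x}q(x,y)$. Assume there is a constant $C$ with $\sum_{y\in\Lambda}q(y,x)\le C$ for all $x\in\Lambda\cup\{0\}$. Let $\mu$ be a probability measure on $\Lambda$ with $-\sum_{z\in\Lambda}\mu(z)q(z,z)<\infty$. Let $N\ge 2$ and let $(\xi(t))_{t\ge0}$ be the $N$-particle Fleming–Viot process driven by $Q$, started from a configuration $\xi(0)\in\Lambda^N$. Then for every $T>0$ and every $x\in\Lambda$, $$\sup_{0\le t\le T} E\left|m(x,\xi(t))-T_t\mu(x)\right|\le e^{5CT}\left(\frac{3}{\sqrt N}+\|\mu-m(\xi(0))\|_{TV}\right).$$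
   Context: For a probability measure $\mu$ on $\Lambda$, $Z(\cdot,\mu)$ denotes the process with initial law $\mu$, $\tau^\mu=\inf\{t>0: Z(t,\mu)=0\}$ its absorption time, and $T_t\mu(x):=P(Z(t,\mu)=x\mid \tau^\mu>t)$, $x\in\Lambda$, is the conditioned evolution. The $N$-particle Fleming–Viot process driven by $Q$ is the Markov process on $\Lambda^N$ (with $\xi(t,i)$ the position of particle $i$) with generator $$\mathcal L^N f(\xi)=\sum_{i=1}^N\sum_{x\in\Lambda}\Big[q(\xi(i),x)+q(\xi(i),0)\frac{\sum_{j\neq i}\mathbf 1\{\xi(j)=x\}}{N-1}\Big]\big(f(\xi^{i,x})-f(\xi)\big),$$ where $\xi^{i,x}(i)=x$ and $\xi^{i,x}(j)=\xi(j)$ for $j\ne i$: particles move independently with rates $Q$, and when a particle attempts to jump to $0$ it instead jumps to the position of one of the other $N-1$ particles chosen uniformly at random. For $\xi\in\Lambda^N$, $m(x,\xi):=\frac1N\sum_{i=1}^N\mathbf 1\{\xi(i)=x\}$, and $m(\xi)$ denotes the probability measure $m(\cdot,\xi)$ on $\Lambda$. $\|\cdot\|_{TV}$ is the total variation norm. *)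

theory Defs
  imports "HOL-Probability.Probability"
begin

section \<open>Minimal continuous-time Markov chain on a countable state space\<close>

text \<open>A rate function r on a countable type 's; only off-diagonal entries are used.
  The total exit rate of x is the sum of the off-diagonal rates out of x.\<close>

definition exit_rate :: "('s \<Rightarrow> 's \<Rightarrow> real) \<Rightarrow> 's \<Rightarrow> real" where
  "exit_rate r x = (\<Sum>\<^sub>\<infinity> y \<in> - {x}. r x y)"

text \<open>Feller's backward iteration; its supremum is the minimal solution of the backward
  Kolmogorov integral equation, i.e. the transition function of the (minimal)
  Markov jump process with rates r.\<close>

fun ctmc_iter :: "('s \<Rightarrow> 's \<Rightarrow> real) \<Rightarrow> nat \<Rightarrow> real \<Rightarrow> 's \<Rightarrow> 's \<Rightarrow> ennreal" where
  "ctmc_iter r 0 t x y = (if x = y then ennreal (exp (- exit_rate r x * t)) else 0)"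
| "ctmc_iter r (Suc n) t x y =
     ctmc_iter r 0 t x y +
     (\<integral>\<^sup>+ s. indicator {0..t} s * ennreal (exp (- exit_rate r x * s)) *
        (\<integral>\<^sup>+ z. ennreal (r x z) * ctmc_iter r n (t - s) z y \<partial>count_space (- {x})) \<partial>lborel)"

definition ctmc_trans :: "('s \<Rightarrow> 's \<Rightarrow> real) \<Rightarrow> real \<Rightarrow> 's \<Rightarrow> 's \<Rightarrow> ennreal" where
  "ctmc_trans r t x y = (SUP n. ctmc_iter r n t x y)"

section \<open>The absorbed chain Z on \<Lambda> \<union> {0}; state 0 is None, \<Lambda> is the type 'a\<close>

definition rate_matrix :: "('s \<Rightarrow> 's \<Rightarrow> real) \<Rightarrow> bool" where
  "rate_matrix q \<longleftrightarrow> (\<forall>x y. x \<noteq> y \<longrightarrow> 0 \<le> q x y) \<and>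
     (\<forall>x. (\<lambda>y. q x y) summable_on (- {x}) \<and> q x x = - (\<Sum>\<^sub>\<infinity> y \<in> - {x}. q x y))"

definition non_exploding :: "('s \<Rightarrow> 's \<Rightarrow> real) \<Rightarrow> bool" where
  "non_exploding q \<longleftrightarrow> (\<forall>t\<ge>0. \<forall>x. (\<integral>\<^sup>+ y. ctmc_trans q t x y \<partial>count_space UNIV) = 1)"

definition irreducible_on_Lambda :: "('a option \<Rightarrow> 'a option \<Rightarrow> real) \<Rightarrow> bool" where
  "irreducible_on_Lambda q \<longleftrightarrow>
     (\<forall>x y. (x, y) \<in> {(a, b). a \<noteq> b \<and> q (Some a) (Some b) > 0}\<^sup>*)"

definition absorbing_zero :: "('a option \<Rightarrow> 'a option \<Rightarrow> real) \<Rightarrow> bool" where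
  "absorbing_zero q \<longleftrightarrow> (\<forall>y. q None y = 0)"

definition certain_absorption :: "('a option \<Rightarrow> 'a option \<Rightarrow> real) \<Rightarrow> bool" where
  "certain_absorption q \<longleftrightarrow> (\<forall>x. ((\<lambda>t. ctmc_trans q t (Some x) None) \<longlongrightarrow> 1) at_top)"

text \<open>Probability measures on \<Lambda> as mass functions.\<close>
definition prob_fun :: "('a \<Rightarrow> real) \<Rightarrow> bool" where
  "prob_fun \<mu> \<longleftrightarrow> (\<forall>z. 0 \<le> \<mu> z) \<and> (\<mu> has_sum 1) UNIV"

text \<open>Conditioned evolution T_t \<mu> (x) = P(Z(t,\<mu>) = x | \<tau> > t); as 0 is absorbing,
  \<tau> > t iff Z(t,\<mu>) \<in> \<Lambda>.\<close>
definition law_at :: "('a option \<Rightarrow> 'a option \<Rightarrow> real) \<Rightarrow> ('a \<Rightarrow> real) \<Rightarrow> real \<Rightarrow> 'a \<Rightarrow> real" where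
  "law_at q \<mu> t x = (\<Sum>\<^sub>\<infinity> z. \<mu> z * enn2real (ctmc_trans q t (Some z) (Some x)))"

definition cond_evol :: "('a option \<Rightarrow> 'a option \<Rightarrow> real) \<Rightarrow> ('a \<Rightarrow> real) \<Rightarrow> real \<Rightarrow> 'a \<Rightarrow> real" where
  "cond_evol q \<mu> t x = law_at q \<mu> t x / (\<Sum>\<^sub>\<infinity> y. law_at q \<mu> t y)"

section \<open>Fleming--Viot process on \<Lambda>^N (configurations as lists of length N)\<close>

text \<open>Rate of the jump \<xi> \<rightarrow> \<xi>^{i,x} (x \<noteq> \<xi>(i), x \<in> \<Lambda>):
  q(\<xi>(i),x) + q(\<xi>(i),0) * #{j \<noteq> i. \<xi>(j) = x}/(N-1). Distinct (i,x) give distinct targets.\<close>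
definition fv_rate :: "('a option \<Rightarrow> 'a option \<Rightarrow> real) \<Rightarrow> nat \<Rightarrow> 'a list \<Rightarrow> 'a list \<Rightarrow> real" where
  "fv_rate q N \<xi> \<eta> = (\<Sum>i<N.
     if length \<xi> = N \<and> length \<eta> = N \<and> \<eta> ! i \<noteq> \<xi> ! i \<and> (\<forall>j<N. j \<noteq> i \<longrightarrow> \<eta> ! j = \<xi> ! j)
     then q (Some (\<xi> ! i)) (Some (\<eta> ! i)) +
          q (Some (\<xi> ! i)) None * real (card {j. j < N \<and> j \<noteq> i \<and> \<xi> ! j = \<eta> ! i}) / real (N - 1)
     else 0)"

text \<open>Empirical measure m(x,\<xi>).\<close>
definition emp :: "'a list \<Rightarrow> 'a \<Rightarrow> real" where
  "emp \<xi> x = real (card {i. i < length \<xi> \<and> \<xi> ! i = x}) / real (length \<xi>)"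

text \<open>E |m(x,\<xi>(t)) - a| for the FV process started at \<xi>0.\<close>
definition fv_abs_dev :: "('a option \<Rightarrow> 'a option \<Rightarrow> real) \<Rightarrow> nat \<Rightarrow> 'a list \<Rightarrow> real \<Rightarrow> 'a \<Rightarrow> real \<Rightarrow> ennreal" where
  "fv_abs_dev q N \<xi>0 t x a =
     (\<integral>\<^sup>+ \<eta>. ctmc_trans (fv_rate q N) t \<xi>0 \<eta> * ennreal \<bar>emp \<eta> x - a\<bar> \<partial>count_space UNIV)"

text \<open>Total variation norm of a signed difference: sum of absolute values.\<close>
definition tv_norm :: "('a \<Rightarrow> real) \<Rightarrow> ('a \<Rightarrow> real) \<Rightarrow> real" where
  "tv_norm \<mu> \<nu> = (\<Sum>\<^sub>\<infinity> y. \<bar>\<mu> y - \<nu> y\<bar>)"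

end

theory Submission
  imports Defs
begin

text \<open>Fix the horizon t, put a = T_t \<mu>(x), and let h_s = P_s (1_x - a 1_\<Lambda>), where P is the killed
  semigroup on \<Lambda>; then |h_s| \<le> 1 and \<mu>(h_t) = 0. For a configuration \<xi> let
  V_s(\<xi>) be the sum of h_s(\<xi>(i)) h_s(\<xi>(j)) over i \<noteq> j, and S_s(\<xi>) the sum of all h_s(\<xi>(i)).
  As V_s is affine in each particle, the unbounded jump rates cancel and, with L the
  Fleming--Viot generator,
    (d/ds - L) V_s = - 2/(N-1) \<Sum>_i q(\<xi>(i),0) (S_s - h_s(\<xi>(i)))^2.
  The killing rates are at most C, so exp(10 C s) (V_s + 2N) is a supersolution of the backward
  equation. It dominates S_0^2 = N^2 (m(x,\<xi>) - a)^2 at s = 0, and at s = t it is at most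
  exp(10 C t) N^2 (TV^2 + 2/N), where TV is the distance of \<mu> and m(\<xi>(0)). Passing to the first
  moment by |v| \<le> v^2/(2 \<epsilon>) + \<epsilon>/2 and optimising \<epsilon> gives the bound.\<close>

section \<open>Backward equation and comparison\<close>

text \<open>T_t \<mu> is a quotient, hence nonlinear in \<mu>. Freezing a = T_t \<mu>(x) for one t
  at a time replaces the quotient by the linear test function h_s and turns the normalisation into
  the single centring identity \<mu>(h_t) = 0. The variable s is the time still to run: the data sit
  at s = 0, and the initial configuration is evaluated at s = t.

  The diagonal is left out of V_s because S_s^2 would contribute, for each particle, the
  rate-weighted sum of squared increments of h_s; this is of the order of the exit rate, and C
  bounds column sums, not row sums.

  The square on the right-hand side arises as follows. Z sends a killed particle to 0, where h_s =
  0; here it moves to another particle, with mean value (S_s - h_s(\<xi>(i)))/(N-1). This excess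
  drift is multiplied by the derivative of V_s in h_s(\<xi>(i)), which is 2 (S_s - h_s(\<xi>(i))).

  Constants: 10 is twice 5, as a square root is taken at the end. Of the 2N, one N pays for the
  missing diagonal and the other absorbs the additive constant in the bound on the square. Finally
  2/N is at most 9/N, the square of 3/sqrt N.\<close>

lemma borel_measurable_nn_integral_count_space:
  assumes "countable I" "\<And>i. i \<in> I \<Longrightarrow> f i \<in> borel_measurable M"
  shows "(\<lambda>s. \<integral>\<^sup>+ i. f i s \<partial>count_space I) \<in> borel_measurable M"
proof -
  interpret sigma_finite_measure "count_space I"
    using assms(1) by (rule sigma_finite_measure_count_space_countable)
  have "(\<lambda>(i, s). f i s) \<in> borel_measurable (count_space I \<Otimes>\<^sub>M M)"
    using assms by (intro measurable_pair_measure_countable1) auto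
  then have "(\<lambda>(s, i). f i s) \<in> borel_measurable (M \<Otimes>\<^sub>M count_space I)"
    by (subst (asm) measurable_pair_swap_iff) (simp add: case_prod_unfold)
  then show ?thesis
    by (intro borel_measurable_nn_integral) simp
qed

lemma ctmc_iter_measurable [measurable]:
  fixes r :: "'s::countable \<Rightarrow> 's \<Rightarrow> real"
  shows "(\<lambda>t. ctmc_iter r n t x y) \<in> borel_measurable borel"
proof (induction n arbitrary: x)
  case 0
  show ?case by simp
next
  case (Suc n)
  have [measurable]: "(\<lambda>s. \<integral>\<^sup>+ z. ennreal (r x z) * ctmc_iter r n s z y \<partial>count_space (- {x}))
      \<in> borel_measurable borel"
    using Suc by (intro borel_measurable_nn_integral_count_space) auto
  \<comment> \<open>The interval has a moving endpoint; written as a condition on the pair (t, s),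
    it is jointly measurable by the standard rules.\<close>
  have ind: "indicator {0..t} s = (if 0 \<le> s \<and> s \<le> t then 1 else 0 :: ennreal)" for s t :: real
    by (simp add: indicator_def)
  have "(\<lambda>t. \<integral>\<^sup>+ s. indicator {0..t} s * ennreal (exp (- exit_rate r x * s)) *
        (\<integral>\<^sup>+ z. ennreal (r x z) * ctmc_iter r n (t - s) z y \<partial>count_space (- {x})) \<partial>lborel)
      \<in> borel_measurable borel"
    unfolding ind by measurable
  then show ?case
    by simp
qed

lemma incseq_ctmc_iter: "incseq (\<lambda>n. ctmc_iter r n t x y)"
proof (rule incseq_SucI)
  fix n
  show "ctmc_iter r n t x y \<le> ctmc_iter r (Suc n) t x y"
  proof (induction n arbitrary: t x)
    case 0
    show ?case by simp
  next
    case (Suc n)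
    show ?case
      unfolding ctmc_iter.simps(2)[of r n t x y] ctmc_iter.simps(2)[of r "Suc n" t x y]
      by (intro add_mono order_refl nn_integral_mono mult_left_mono Suc zero_le)
  qed
qed

definition ctmc_expect_iter :: "('s \<Rightarrow> 's \<Rightarrow> real) \<Rightarrow> ('s \<Rightarrow> ennreal) \<Rightarrow> nat \<Rightarrow> real \<Rightarrow> 's \<Rightarrow> ennreal" where
  "ctmc_expect_iter r g n t x = (\<integral>\<^sup>+ y. ctmc_iter r n t x y * g y \<partial>count_space UNIV)"

definition ctmc_expect :: "('s \<Rightarrow> 's \<Rightarrow> real) \<Rightarrow> ('s \<Rightarrow> ennreal) \<Rightarrow> real \<Rightarrow> 's \<Rightarrow> ennreal" where
  "ctmc_expect r g t x = (\<integral>\<^sup>+ y. ctmc_trans r t x y * g y \<partial>count_space UNIV)"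

text \<open>Conditioning on the first jump, at time s to state z. Fixed points solve the backward
  equation with initial datum \<open>g\<close>; a \<open>u\<close> that is not increased by the step
  is a supersolution.\<close>

definition backward_step ::
  "('s \<Rightarrow> 's \<Rightarrow> real) \<Rightarrow> ('s \<Rightarrow> ennreal) \<Rightarrow> (real \<Rightarrow> 's \<Rightarrow> ennreal) \<Rightarrow> real \<Rightarrow> 's \<Rightarrow> ennreal" where
  "backward_step r g u t x = ennreal (exp (- exit_rate r x * t)) * g x +
     (\<integral>\<^sup>+ s. indicator {0..t} s * ennreal (exp (- exit_rate r x * s)) *
        (\<integral>\<^sup>+ z. ennreal (r x z) * u (t - s) z \<partial>count_space (- {x})) \<partial>lborel)"

lemma ctmc_expect_iter_measurable [measurable]:
  fixes r :: "'s::countable \<Rightarrow> 's \<Rightarrow> real"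
  shows "(\<lambda>t. ctmc_expect_iter r g n t x) \<in> borel_measurable borel"
  unfolding ctmc_expect_iter_def by (intro borel_measurable_nn_integral_count_space) auto

lemma ctmc_expect_iter_0:
  "ctmc_expect_iter r g 0 t x = ennreal (exp (- exit_rate r x * t)) * g x"
proof -
  have "ctmc_expect_iter r g 0 t x =
      (\<integral>\<^sup>+ y. (ennreal (exp (- exit_rate r x * t)) * g x) * indicator {x} y \<partial>count_space UNIV)"
    unfolding ctmc_expect_iter_def by (intro nn_integral_cong) auto
  then show ?thesis
    by simp
qed

text \<open>Tonelli twice: the weight \<open>g\<close> passes through the integral over the jump
  time and then through the sum over the jump target.\<close>

lemma ctmc_expect_iter_Suc:
  fixes r :: "'s::countable \<Rightarrow> 's \<Rightarrow> real"
  shows "ctmc_expect_iter r g (Suc n) t x = backward_step r g (ctmc_expect_iter r g n) t x"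
proof -
  let ?e = "\<lambda>s. indicator {0..t} s * ennreal (exp (- exit_rate r x * s))"
  let ?k = "\<lambda>s y. \<integral>\<^sup>+ z. ennreal (r x z) * ctmc_iter r n (t - s) z y \<partial>count_space (- {x})"
  have [measurable]: "(\<lambda>s. ?k s y) \<in> borel_measurable borel" for y
    by (intro borel_measurable_nn_integral_count_space) auto
  have "(\<integral>\<^sup>+ y. (\<integral>\<^sup>+ s. ?e s * ?k s y \<partial>lborel) * g y \<partial>count_space UNIV)
      = (\<integral>\<^sup>+ y. (\<integral>\<^sup>+ s. ?e s * ?k s y * g y \<partial>lborel) \<partial>count_space UNIV)"
    by (intro nn_integral_cong nn_integral_multc[symmetric]) measurable
  also have "\<dots> = (\<integral>\<^sup>+ s. (\<integral>\<^sup>+ y. ?e s * ?k s y * g y \<partial>count_space UNIV) \<partial>lborel)"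
    by (intro nn_integral_count_space_nn_integral[symmetric]) (auto, measurable)
  also have "\<dots> = (\<integral>\<^sup>+ s. ?e s *
      (\<integral>\<^sup>+ z. ennreal (r x z) * ctmc_expect_iter r g n (t - s) z \<partial>count_space (- {x})) \<partial>lborel)"
  proof (intro nn_integral_cong)
    fix s :: real
    have "(\<integral>\<^sup>+ y. ?k s y * g y \<partial>count_space UNIV)
      = (\<integral>\<^sup>+ y. (\<integral>\<^sup>+ z. ennreal (r x z) * ctmc_iter r n (t - s) z y * g y \<partial>count_space (- {x}))
            \<partial>count_space UNIV)"
      by (intro nn_integral_cong nn_integral_multc[symmetric]) auto
    also have "\<dots> = (\<integral>\<^sup>+ z. (\<integral>\<^sup>+ y. ennreal (r x z) * ctmc_iter r n (t - s) z y * g y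
        \<partial>count_space UNIV) \<partial>count_space (- {x}))"
      by (intro nn_integral_count_space_nn_integral) auto
    also have "\<dots> = (\<integral>\<^sup>+ z. ennreal (r x z) * ctmc_expect_iter r g n (t - s) z \<partial>count_space (- {x}))"
      unfolding ctmc_expect_iter_def mult.assoc
      by (intro nn_integral_cong nn_integral_cmult) auto
    finally show "(\<integral>\<^sup>+ y. ?e s * ?k s y * g y \<partial>count_space UNIV) = ?e s *
      (\<integral>\<^sup>+ z. ennreal (r x z) * ctmc_expect_iter r g n (t - s) z \<partial>count_space (- {x}))"
      by (simp add: mult.assoc nn_integral_cmult)
  qed
  finally have *: "(\<integral>\<^sup>+ y. (\<integral>\<^sup>+ s. ?e s * ?k s y \<partial>lborel) * g y \<partial>count_space UNIV) = \<dots>" .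
  have "ctmc_expect_iter r g (Suc n) t x = ctmc_expect_iter r g 0 t x +
      (\<integral>\<^sup>+ y. (\<integral>\<^sup>+ s. ?e s * ?k s y \<partial>lborel) * g y \<partial>count_space UNIV)"
    unfolding ctmc_expect_iter_def ctmc_iter.simps(2) distrib_right
    by (intro nn_integral_add) auto
  then show ?thesis
    unfolding * ctmc_expect_iter_0 backward_step_def .
qed

lemma incseq_ctmc_expect_iter: "incseq (\<lambda>n. ctmc_expect_iter r g n t x)"
  unfolding ctmc_expect_iter_def mono_def
  by (auto intro!: nn_integral_mono mult_right_mono incseq_ctmc_iter[THEN incseqD])

lemma ctmc_expect_eq_SUP: "ctmc_expect r g t x = (SUP n. ctmc_expect_iter r g n t x)"
proof -
  have "incseq (\<lambda>n y. ctmc_iter r n t x y * g y)"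
    using incseq_ctmc_iter[THEN incseqD] by (auto simp: mono_def le_fun_def intro!: mult_right_mono)
  then show ?thesis
    unfolding ctmc_expect_def ctmc_expect_iter_def ctmc_trans_def SUP_mult_right_ennreal
    by (intro nn_integral_monotone_convergence_SUP) auto
qed

lemma ctmc_expect_measurable [measurable]:
  fixes r :: "'s::countable \<Rightarrow> 's \<Rightarrow> real"
  shows "(\<lambda>t. ctmc_expect r g t x) \<in> borel_measurable borel"
  unfolding ctmc_expect_eq_SUP by measurable

lemma ctmc_expect_mono: "(\<And>y. g y \<le> g' y) \<Longrightarrow> ctmc_expect r g t x \<le> ctmc_expect r g' t x"
  unfolding ctmc_expect_def by (intro nn_integral_mono mult_left_mono) auto

text \<open>Comparing only at states reachable in one jump allows the argument to be run on a closed
  set, such as the lists of length N among all lists.\<close>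

lemma backward_step_mono:
  assumes "\<And>s z. 0 \<le> s \<Longrightarrow> s \<le> t \<Longrightarrow> z \<noteq> x \<Longrightarrow> r x z \<noteq> 0 \<Longrightarrow> u s z \<le> v s z"
  shows "backward_step r g u t x \<le> backward_step r g v t x"
  unfolding backward_step_def
proof (intro add_left_mono nn_integral_mono)
  fix s :: real
  have "(\<integral>\<^sup>+ z. ennreal (r x z) * u (t - s) z \<partial>count_space (- {x}))
      \<le> (\<integral>\<^sup>+ z. ennreal (r x z) * v (t - s) z \<partial>count_space (- {x}))" if "s \<in> {0..t}"
  proof (rule nn_integral_mono)
    fix z assume "z \<in> space (count_space (- {x}))"
    then show "ennreal (r x z) * u (t - s) z \<le> ennreal (r x z) * v (t - s) z"
      using that assms[of "t - s" z] by (cases "r x z = 0") (auto intro: mult_left_mono)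
  qed
  then show "indicator {0..t} s * ennreal (exp (- exit_rate r x * s)) *
        (\<integral>\<^sup>+ z. ennreal (r x z) * u (t - s) z \<partial>count_space (- {x}))
     \<le> indicator {0..t} s * ennreal (exp (- exit_rate r x * s)) *
        (\<integral>\<^sup>+ z. ennreal (r x z) * v (t - s) z \<partial>count_space (- {x}))"
    by (cases "s \<in> {0..t}") (auto intro: mult_left_mono)
qed

text \<open>Only an upper bound is needed in the end, so comparison with supersolutions suffices and
  explosion of the Fleming--Viot chain never has to be excluded.\<close>
lemma ctmc_expect_least:
  fixes r :: "'s::countable \<Rightarrow> 's \<Rightarrow> real"
  assumes closed: "\<And>x z. x \<in> A \<Longrightarrow> z \<notin> A \<Longrightarrow> r x z = 0"
    and super: "\<And>t x. 0 \<le> t \<Longrightarrow> t \<le> T \<Longrightarrow> x \<in> A \<Longrightarrow> backward_step r g u t x \<le> u t x"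
    and "0 \<le> t" "t \<le> T" "x \<in> A"
  shows "ctmc_expect r g t x \<le> u t x"
proof -
  have "ctmc_expect_iter r g n t x \<le> u t x" for n
    using assms(3-5)
  proof (induction n arbitrary: t x)
    case 0
    have "ctmc_expect_iter r g 0 t x \<le> backward_step r g u t x"
      unfolding ctmc_expect_iter_0 backward_step_def by simp
    also note super[OF 0]
    finally show ?case .
  next
    case (Suc n)
    have "ctmc_expect_iter r g (Suc n) t x \<le> backward_step r g u t x"
      unfolding ctmc_expect_iter_Suc
      using Suc.prems closed by (intro backward_step_mono Suc.IH) auto
    also note super[OF Suc.prems]
    finally show ?case .
  qed
  then show ?thesis
    unfolding ctmc_expect_eq_SUP by (intro SUP_least)
qed

text \<open>Monotone convergence in the recursion. For the absorbed chain an upper bound is not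
  enough: its expectations serve as test functions and are differentiated in time, which requires
  the equation itself.\<close>

lemma ctmc_expect_backward:
  fixes r :: "'s::countable \<Rightarrow> 's \<Rightarrow> real"
  shows "ctmc_expect r g t x = backward_step r g (ctmc_expect r g) t x"
proof -
  let ?e = "\<lambda>s. indicator {0..t} s * ennreal (exp (- exit_rate r x * s))"
  let ?k = "\<lambda>n s. \<integral>\<^sup>+ z. ennreal (r x z) * ctmc_expect_iter r g n (t - s) z \<partial>count_space (- {x})"
  have [measurable]: "(\<lambda>s. ?k n s) \<in> borel_measurable borel" for n
    by (intro borel_measurable_nn_integral_count_space) auto
  have inc: "incseq ?k"
    unfolding mono_def le_fun_def
    by (auto intro!: nn_integral_mono mult_left_mono incseq_ctmc_expect_iter[THEN incseqD])
  have k: "(\<integral>\<^sup>+ z. ennreal (r x z) * ctmc_expect r g (t - s) z \<partial>count_space (- {x})) = (SUP n. ?k n s)" for s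
    unfolding ctmc_expect_eq_SUP SUP_mult_left_ennreal
    by (intro nn_integral_monotone_convergence_SUP)
       (auto simp: mono_def le_fun_def intro!: mult_left_mono incseq_ctmc_expect_iter[THEN incseqD])
  have "(\<integral>\<^sup>+ s. ?e s * (SUP n. ?k n s) \<partial>lborel) = (SUP n. \<integral>\<^sup>+ s. ?e s * ?k n s \<partial>lborel)"
    unfolding SUP_mult_left_ennreal
    using inc by (intro nn_integral_monotone_convergence_SUP)
       (auto simp: mono_def le_fun_def intro!: mult_left_mono)
  then have "backward_step r g (ctmc_expect r g) t x = (SUP n. ctmc_expect_iter r g (Suc n) t x)"
    unfolding ctmc_expect_iter_Suc backward_step_def k
    by (simp add: ennreal_SUP_add_right)
  also have "\<dots> = ctmc_expect r g t x"
    unfolding ctmc_expect_eq_SUP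
    by (intro antisym SUP_least SUP_upper UNIV_I)
       (rule order.trans[OF incseq_SucD[OF incseq_ctmc_expect_iter] SUP_upper[OF UNIV_I,
         where f = "\<lambda>n. ctmc_expect_iter r g (Suc n) t x"]])
  finally show ?thesis by simp
qed

section \<open>Real sums, rate matrices, and the differential form of the supersolution
  inequality\<close>

lemma summable_on_real_iff_integrable:
  fixes f :: "'b \<Rightarrow> real"
  shows "f summable_on A \<longleftrightarrow> integrable (count_space A) f"
  using summable_on_iff_abs_summable_on_real[of f A] abs_summable_equivalent[of f A]
  unfolding abs_summable_on_def by blast

lemma nn_integral_count_space_eq_infsum:
  fixes f :: "'b \<Rightarrow> real"
  assumes "f summable_on A" "\<And>x. x \<in> A \<Longrightarrow> 0 \<le> f x"
  shows "(\<integral>\<^sup>+ x. ennreal (f x) \<partial>count_space A) = ennreal (infsum f A)"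
proof -
  have "Infinite_Set_Sum.abs_summable_on f A"
    using assms(1) unfolding abs_summable_on_def summable_on_real_iff_integrable .
  with assms(2) show ?thesis
    using nn_integral_conv_infsetsum[of f A] infsetsum_infsum[of f A] by simp
qed

lemma summable_on_of_nn_integral_finite:
  fixes f :: "'b \<Rightarrow> real"
  assumes "(\<integral>\<^sup>+ x. ennreal (f x) \<partial>count_space A) < \<infinity>" "\<And>x. x \<in> A \<Longrightarrow> 0 \<le> f x"
  shows "f summable_on A"
  unfolding summable_on_real_iff_integrable
  using assms by (intro integrableI_nonneg) (auto simp: AE_count_space)

lemma rate_matrix_nonneg: "rate_matrix q \<Longrightarrow> x \<noteq> y \<Longrightarrow> 0 \<le> q x y"
  by (simp add: rate_matrix_def)

lemma rate_matrix_summable: "rate_matrix q \<Longrightarrow> q x summable_on (- {x})"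
  by (simp add: rate_matrix_def)

lemma exit_rate_nonneg: "rate_matrix q \<Longrightarrow> 0 \<le> exit_rate q x"
  unfolding exit_rate_def by (intro infsum_nonneg) (auto intro: rate_matrix_nonneg)

lemma rate_matrix_nn_integral:
  "rate_matrix q \<Longrightarrow> (\<integral>\<^sup>+ z. ennreal (q x z) \<partial>count_space (- {x})) = ennreal (exit_rate q x)"
  unfolding exit_rate_def
  by (intro nn_integral_count_space_eq_infsum) (auto simp: rate_matrix_def)

lemma rate_matrix_integrable: "rate_matrix q \<Longrightarrow> integrable (count_space (- {x})) (q x)"
  using rate_matrix_summable unfolding summable_on_real_iff_integrable .

text \<open>Integrating factor: the inequality W' >= L W at the state \<open>x\<close>, multiplied
  by exp(-l s) with l the exit rate, integrates to the first-jump inequality. The diagonal part of L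
  is moved to the side of \<open>D\<close>, so both sides of \<open>gen\<close> are nonnegative and
  can be compared in \<open>ennreal\<close> without a separate integrability proof for
  \<open>W s\<close> under the jump rates.\<close>

lemma backward_step_le:
  fixes W :: "real \<Rightarrow> 's \<Rightarrow> real" and D :: "real \<Rightarrow> real"
  assumes "0 \<le> t"
    and deriv: "\<And>s. s \<in> {0..t} \<Longrightarrow> ((\<lambda>s. W s x) has_real_derivative D s) (at s within {0..t})"
    and nonneg: "\<And>s. s \<in> {0..t} \<Longrightarrow> 0 \<le> D s + exit_rate r x * W s x"
    and gen: "\<And>s. s \<in> {0..t} \<Longrightarrow>
      (\<integral>\<^sup>+ z. ennreal (r x z) * ennreal (W s z) \<partial>count_space (- {x})) \<le> ennreal (D s + exit_rate r x * W s x)"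
    and init: "g x \<le> ennreal (W 0 x)" "0 \<le> W 0 x"
  shows "backward_step r g (\<lambda>s z. ennreal (W s z)) t x \<le> ennreal (W t x)"
proof -
  let ?l = "exit_rate r x"
  \<comment> \<open>After a first jump at time s the time t - s remains, so \<open>W\<close> is read
    backwards; \<open>f\<close> is the derivative of - exp(-l s) W(t - s, x).\<close>
  define f where "f s = exp (- ?l * s) * (D (t - s) + ?l * W (t - s) x)" for s
  have "((\<lambda>s. W (t - s) x) has_real_derivative - D (t - s)) (at s within {0..t})"
    if "s \<in> {0..t}" for s
  proof -
    have "((\<lambda>s. W s x) has_real_derivative D (t - s)) (at (t - s) within (\<lambda>s. t - s) ` {0..t})"
      using deriv[of "t - s"] that by simp
    moreover have "((\<lambda>s. t - s) has_real_derivative -1) (at s within {0..t})"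
      by (auto intro!: derivative_eq_intros)
    ultimately have "(((\<lambda>s. W s x) \<circ> (\<lambda>s. t - s)) has_real_derivative D (t - s) * -1) (at s within {0..t})"
      by (rule DERIV_image_chain)
    then show ?thesis
      by (simp add: o_def)
  qed
  note [derivative_intros] = this
  have "((\<lambda>s. - exp (- ?l * s) * W (t - s) x) has_real_derivative f s) (at s within {0..t})"
    if "s \<in> {0..t}" for s
    unfolding f_def using that
    by (auto intro!: derivative_eq_intros simp: algebra_simps)
  then have f_int: "(f has_integral (W t x - exp (- ?l * t) * W 0 x)) {0..t}"
    using fundamental_theorem_of_calculus[of 0 t "\<lambda>s. - exp (- ?l * s) * W (t - s) x" f] \<open>0 \<le> t\<close>
    by (simp add: has_real_derivative_iff_has_vector_derivative)
  have f_nonneg: "0 \<le> f s" if "s \<in> {0..t}" for s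
    using nonneg[of "t - s"] that by (simp add: f_def)
  have le: "0 \<le> W t x - exp (- ?l * t) * W 0 x"
    using f_int f_nonneg by (rule has_integral_nonneg)
  have I: "(\<integral>\<^sup>+ s. ennreal (f s) * indicator {0..t} s \<partial>lborel) = ennreal (W t x - exp (- ?l * t) * W 0 x)"
    by (intro nn_integral_has_integral_lebesgue' f_int f_nonneg)
  have "(\<integral>\<^sup>+ s. indicator {0..t} s * ennreal (exp (- ?l * s)) *
        (\<integral>\<^sup>+ z. ennreal (r x z) * ennreal (W (t - s) z) \<partial>count_space (- {x})) \<partial>lborel)
      \<le> (\<integral>\<^sup>+ s. ennreal (f s) * indicator {0..t} s \<partial>lborel)"
  proof (rule nn_integral_mono)
    fix s :: real
    show "indicator {0..t} s * ennreal (exp (- ?l * s)) *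
        (\<integral>\<^sup>+ z. ennreal (r x z) * ennreal (W (t - s) z) \<partial>count_space (- {x}))
        \<le> ennreal (f s) * indicator {0..t} s"
    proof (cases "s \<in> {0..t}")
      case True
      then show ?thesis
        using gen[of "t - s"] nonneg[of "t - s"]
        by (auto simp: f_def ennreal_mult intro: mult_left_mono)
    qed simp
  qed
  also note I
  finally have "backward_step r g (\<lambda>s z. ennreal (W s z)) t x
      \<le> ennreal (exp (- ?l * t)) * ennreal (W 0 x) + ennreal (W t x - exp (- ?l * t) * W 0 x)"
    unfolding backward_step_def using init by (intro add_mono mult_left_mono) auto
  also have "\<dots> = ennreal (W t x)"
    using init(2) le by (simp add: ennreal_mult[symmetric] ennreal_plus[symmetric] del: ennreal_plus)
  finally show ?thesis .
qed

text \<open>The constant 1 is a supersolution: its time derivative is 0, and the jump rates out of a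
  state sum to its exit rate.\<close>

lemma ctmc_expect_le_1:
  fixes q :: "'s::countable \<Rightarrow> 's \<Rightarrow> real"
  assumes q: "rate_matrix q" and g: "\<And>y. g y \<le> 1" and "0 \<le> t"
  shows "ctmc_expect q g t x \<le> 1"
proof -
  have "backward_step q g (\<lambda>s z. ennreal 1) t x \<le> ennreal 1" if "0 \<le> t" for t x
    using that g[of x] exit_rate_nonneg[OF q, of x]
    by (intro backward_step_le[where D = "\<lambda>_. 0" and W = "\<lambda>_ _. 1"])
       (simp_all add: rate_matrix_nn_integral[OF q])
  from ctmc_expect_least[where A = UNIV and T = t and u = "\<lambda>_ _. ennreal 1", OF _ this] \<open>0 \<le> t\<close>
  have "ctmc_expect q g t x \<le> ennreal 1"
    by blast
  then show ?thesis by simp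
qed

section \<open>Time regularity of expectations for a rate matrix\<close>

lemma ctmc_expect_bounds:
  fixes q :: "'s::countable \<Rightarrow> 's \<Rightarrow> real"
  assumes "rate_matrix q" "\<And>y. g y \<le> 1" "0 \<le> t"
  shows "ctmc_expect q g t x = ennreal (enn2real (ctmc_expect q g t x))"
    "enn2real (ctmc_expect q g t x) \<le> 1"
proof -
  have le: "ctmc_expect q g t x \<le> 1"
    using assms by (rule ctmc_expect_le_1)
  then show "ctmc_expect q g t x = ennreal (enn2real (ctmc_expect q g t x))"
    by (cases "ctmc_expect q g t x") (auto simp: top_unique)
  show "enn2real (ctmc_expect q g t x) \<le> 1"
    using le by (intro enn2real_leI) auto
qed

lemma rate_matrix_integrable_mult:
  assumes q: "rate_matrix q" and "\<And>z. \<bar>f z\<bar> \<le> 1"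
  shows "integrable (count_space (- {x})) (\<lambda>z. q x z * f z)"
  using assms(2)
  by (intro Bochner_Integration.integrable_bound[OF rate_matrix_integrable[OF q, of x]])
     (auto simp: AE_count_space abs_mult intro!: mult_left_le)

text \<open>The backward equation multiplied by exp(l t), with l the exit rate, after the
  substitution v = t - s. Then t occurs on the integral side only as the upper limit, the form in
  which the fundamental theorem of calculus applies.\<close>

lemma ctmc_expect_has_integral:
  fixes q :: "'s::countable \<Rightarrow> 's \<Rightarrow> real"
  assumes q: "rate_matrix q" and g: "\<And>y. g y \<le> 1" and "0 \<le> t"
  defines "h \<equiv> \<lambda>s z. enn2real (ctmc_expect q g s z)"
  shows "((\<lambda>v. exp (exit_rate q x * v) * (LINT z|count_space (- {x}). q x z * h v z)) has_integral
     (exp (exit_rate q x * t) * h t x - enn2real (g x))) {0..t}"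
proof -
  let ?l = "exit_rate q x"
  \<comment> \<open>\<open>K\<close> and \<open>B\<close> are the same sum, in
    \<open>ennreal\<close> and in the reals. Measurability is available for \<open>K\<close> on the
    whole line, while the two are identified only for v >= 0, where \<open>h\<close> takes values in
    [0, 1].\<close>
  define K where "K v = (\<integral>\<^sup>+ z. ennreal (q x z) * ctmc_expect q g v z \<partial>count_space (- {x}))" for v
  define B where "B v = (LINT z|count_space (- {x}). q x z * h v z)" for v
  have [measurable]: "K \<in> borel_measurable borel"
    unfolding K_def[abs_def] by (intro borel_measurable_nn_integral_count_space) auto
  have h01: "0 \<le> h v z" "h v z \<le> 1" and E: "ctmc_expect q g v z = ennreal (h v z)" if "0 \<le> v" for v z
    using ctmc_expect_bounds[OF q, of g v z] g that unfolding h_def by auto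
  have B_nonneg: "0 \<le> B v" if "0 \<le> v" for v
    unfolding B_def using rate_matrix_nonneg[OF q] h01[OF that]
    by (intro Bochner_Integration.integral_nonneg) auto
  have K: "K v = ennreal (B v)" if "0 \<le> v" for v
  proof -
    have "integrable (count_space (- {x})) (\<lambda>z. q x z * h v z)"
      using h01[OF that] by (intro rate_matrix_integrable_mult[OF q]) auto
    moreover have "K v = (\<integral>\<^sup>+ z. ennreal (q x z * h v z) \<partial>count_space (- {x}))"
      unfolding K_def using rate_matrix_nonneg[OF q] h01[OF that]
      by (intro nn_integral_cong) (auto simp: E[OF that] ennreal_mult)
    ultimately show ?thesis
      using rate_matrix_nonneg[OF q] h01[OF that]
      by (subst (asm) nn_integral_eq_integral) (auto simp: AE_count_space B_def)
  qed
  obtain g' where g': "g x = ennreal g'" "0 \<le> g'"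
    using g[of x] by (cases "g x") (auto simp: top_unique)
  have "ctmc_expect q g t x = ennreal (exp (- ?l * t)) * g x +
      (\<integral>\<^sup>+ s. indicator {0..t} s * ennreal (exp (- ?l * s)) * K (t - s) \<partial>lborel)"
    by (subst ctmc_expect_backward) (simp add: backward_step_def K_def)
  also have "(\<integral>\<^sup>+ s. indicator {0..t} s * ennreal (exp (- ?l * s)) * K (t - s) \<partial>lborel)
     = (\<integral>\<^sup>+ v. indicator {0..t} (t - v) * ennreal (exp (- ?l * (t - v))) * K v \<partial>lborel)"
    by (subst nn_integral_real_affine[where c = "-1" and t = t]) auto
  also have "\<dots> = (\<integral>\<^sup>+ v. ennreal (exp (- ?l * t)) *
      ennreal (exp (?l * v) * enn2real (K v) * indicator {0..t} v) \<partial>lborel)"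
  proof (rule nn_integral_cong)
    fix v :: real
    have "exp (- ?l * (t - v)) = exp (- ?l * t) * exp (?l * v)"
      by (simp add: exp_add[symmetric] algebra_simps)
    then show "indicator {0..t} (t - v) * ennreal (exp (- ?l * (t - v))) * K v =
      ennreal (exp (- ?l * t)) * ennreal (exp (?l * v) * enn2real (K v) * indicator {0..t} v)"
      using K[of v] B_nonneg[of v]
      by (cases "v \<in> {0..t}") (auto simp: ennreal_mult mult.assoc)
  qed
  also have "\<dots> = ennreal (exp (- ?l * t)) *
      (\<integral>\<^sup>+ v. ennreal (exp (?l * v) * enn2real (K v) * indicator {0..t} v) \<partial>lborel)"
    by (intro nn_integral_cmult) auto
  finally have eq: "ennreal (h t x) = ennreal (exp (- ?l * t)) * g x + ennreal (exp (- ?l * t)) *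
      (\<integral>\<^sup>+ v. ennreal (exp (?l * v) * enn2real (K v) * indicator {0..t} v) \<partial>lborel)" (is "_ = _ + _ * ?J")
    by (simp add: E[OF \<open>0 \<le> t\<close>])
  have "?J \<noteq> \<top>"
  proof
    assume "?J = \<top>"
    then show False
      using eq by (simp add: ennreal_mult_top)
  qed
  then obtain J where J: "?J = ennreal J" "0 \<le> J"
    by (cases ?J) auto
  have "ennreal (h t x) = ennreal (exp (- ?l * t) * (g' + J))"
    using eq J g' by (simp add: ennreal_mult distrib_left)
  then have "h t x = exp (- ?l * t) * (g' + J)"
    using h01[OF \<open>0 \<le> t\<close>] g'(2) J(2) by (subst (asm) ennreal_inj) auto
  then have "J = exp (?l * t) * h t x - g'"
    by (simp add: exp_minus field_simps)
  moreover have "((\<lambda>v. exp (?l * v) * enn2real (K v) * indicator {0..t} v) has_integral J) UNIV"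
    using J by (intro nn_integral_has_integral) auto
  then have "((\<lambda>v. if v \<in> {0..t} then exp (?l * v) * B v else 0) has_integral J) UNIV"
    by (rule has_integral_eq[rotated]) (auto simp: K B_nonneg)
  then have "((\<lambda>v. exp (?l * v) * B v) has_integral J) {0..t}"
    unfolding has_integral_restrict_UNIV .
  ultimately show ?thesis
    using g' by (simp add: B_def)
qed

text \<open>Regularity is bootstrapped: the integral form makes each \<open>h\<close> continuous in
  time; dominated convergence with the summable majorant \<open>q x\<close> makes the jump sum
  continuous; the integrand is then continuous, so the integral is differentiable.\<close>

lemma ctmc_expect_has_derivative:
  fixes q :: "'s::countable \<Rightarrow> 's \<Rightarrow> real"
  assumes q: "rate_matrix q" and g: "\<And>y. g y \<le> 1" and s: "s \<in> {0..T}"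
  defines "h \<equiv> \<lambda>s z. enn2real (ctmc_expect q g s z)"
  shows "((\<lambda>s. h s x) has_real_derivative
     (LINT z|count_space (- {x}). q x z * h s z) - exit_rate q x * h s x) (at s within {0..T})"
proof -
  let ?B = "\<lambda>x v. LINT z|count_space (- {x}). q x z * h v z"
  let ?f = "\<lambda>x v. exp (exit_rate q x * v) * ?B x v"
  have I: "(?f x has_integral (exp (exit_rate q x * t) * h t x - enn2real (g x))) {0..t}"
    if "0 \<le> t" for t x
    using ctmc_expect_has_integral[OF q g that, of x] unfolding h_def .
  have h_eq: "h t x = exp (- exit_rate q x * t) * (enn2real (g x) + integral {0..t} (?f x))"
    if "0 \<le> t" for t x
    using integral_unique[OF I[OF that, of x]] by (simp add: exp_minus field_simps)
  have cont_h: "continuous_on {0..T} (\<lambda>t. h t x)" for x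
  proof -
    have "continuous_on {0..T} (\<lambda>t. exp (- exit_rate q x * t) * (enn2real (g x) + integral {0..t} (?f x)))"
      using s by (intro continuous_intros indefinite_integral_continuous_1 has_integral_integrable[OF I]) auto
    then show ?thesis
      by (rule continuous_on_cong[THEN iffD1, rotated 2]) (auto simp: h_eq)
  qed
  have h01: "0 \<le> h v z" "h v z \<le> 1" if "0 \<le> v" for v z
    using ctmc_expect_bounds[OF q, of g v z] g that unfolding h_def by auto
  have "continuous_on {0..T} (?B x)"
    unfolding continuous_on_sequentially o_def
  proof safe
    fix u :: "nat \<Rightarrow> real" and a
    assume a: "a \<in> {0..T}" and u: "\<forall>n. u n \<in> {0..T}" "u \<longlonglongrightarrow> a"
    show "(\<lambda>n. ?B x (u n)) \<longlonglongrightarrow> ?B x a"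
    proof (rule integral_dominated_convergence)
      show "integrable (count_space (- {x})) (q x)"
        using q by (rule rate_matrix_integrable)
      show "AE z in count_space (- {x}). (\<lambda>n. q x z * h (u n) z) \<longlonglongrightarrow> q x z * h a z"
        using cont_h a u unfolding continuous_on_sequentially o_def
        by (intro AE_I2 tendsto_intros) blast
      show "AE z in count_space (- {x}). norm (q x z * h (u n) z) \<le> q x z" for n
        using rate_matrix_nonneg[OF q, of x] h01[of "u n"] u
        by (auto simp: AE_count_space abs_mult intro!: mult_left_le)
    qed auto
  qed
  then have "continuous_on {0..T} (?f x)"
    by (intro continuous_intros)
  from integral_has_real_derivative[OF this s]
  have "((\<lambda>t. exp (- exit_rate q x * t) * (enn2real (g x) + integral {0..t} (?f x))) has_real_derivative
     ?B x s - exit_rate q x * h s x) (at s within {0..T})"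
    using s h_eq[of s x]
    by (auto intro!: derivative_eq_intros simp: algebra_simps exp_minus)
  then show ?thesis
    by (rule has_field_derivative_transform_within[OF _ zero_less_one s]) (simp add: h_eq)
qed

section \<open>The Fleming--Viot generator\<close>

text \<open>Meaningful as a jump rate for y different from \<xi> ! i only: at y = \<xi> ! i it
  contains the negative diagonal entry of \<open>q\<close>.\<close>

definition fv_kernel :: "('a option \<Rightarrow> 'a option \<Rightarrow> real) \<Rightarrow> nat \<Rightarrow> 'a list \<Rightarrow> nat \<Rightarrow> 'a \<Rightarrow> real" where
  "fv_kernel q N \<xi> i y = q (Some (\<xi> ! i)) (Some y) +
     q (Some (\<xi> ! i)) None * real (card {j. j < N \<and> j \<noteq> i \<and> \<xi> ! j = y}) / real (N - 1)"

lemma fv_kernel_nonneg: "rate_matrix q \<Longrightarrow> y \<noteq> \<xi> ! i \<Longrightarrow> 0 \<le> fv_kernel q N \<xi> i y"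
  by (simp add: fv_kernel_def rate_matrix_nonneg)

lemma fv_rate_closed: "length \<xi> = N \<Longrightarrow> length \<eta> \<noteq> N \<Longrightarrow> fv_rate q N \<xi> \<eta> = 0"
  by (simp add: fv_rate_def)

lemma bij_betw_list_update:
  assumes "i < length \<xi>"
  shows "bij_betw (\<lambda>y. \<xi>[i := y]) (- {\<xi> ! i})
    {\<eta>. length \<eta> = length \<xi> \<and> \<eta> ! i \<noteq> \<xi> ! i \<and> (\<forall>j<length \<xi>. j \<noteq> i \<longrightarrow> \<eta> ! j = \<xi> ! j)}"
  by (rule bij_betw_byWitness[where f' = "\<lambda>\<eta>. \<eta> ! i"])
     (use assms in \<open>auto intro!: nth_equalityI simp: nth_list_update\<close>)

text \<open>A neighbour of \<xi> that differs at coordinate i is \<xi>[i := y] for exactly one y,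
  which reparametrises the sum over configurations by particle and new site.\<close>

lemma nn_integral_fv_rate:
  assumes q: "rate_matrix q" and \<xi>: "length \<xi> = N"
  shows "(\<integral>\<^sup>+ \<eta>. ennreal (fv_rate q N \<xi> \<eta>) * F \<eta> \<partial>count_space (- {\<xi>}))
    = (\<Sum>i<N. \<integral>\<^sup>+ y. ennreal (fv_kernel q N \<xi> i y) * F (\<xi>[i := y]) \<partial>count_space (- {\<xi> ! i}))"
proof -
  define B where "B i = {\<eta>. length \<eta> = length \<xi> \<and> \<eta> ! i \<noteq> \<xi> ! i \<and>
    (\<forall>j<length \<xi>. j \<noteq> i \<longrightarrow> \<eta> ! j = \<xi> ! j)}" for i
  have rate: "ennreal (fv_rate q N \<xi> \<eta>) =
      (\<Sum>i<N. if \<eta> \<in> B i then ennreal (fv_kernel q N \<xi> i (\<eta> ! i)) else 0)" for \<eta>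
  proof -
    have "fv_rate q N \<xi> \<eta> = (\<Sum>i<N. if \<eta> \<in> B i then fv_kernel q N \<xi> i (\<eta> ! i) else 0)"
      unfolding fv_rate_def using \<xi> by (intro sum.cong) (auto simp: B_def fv_kernel_def)
    also have "ennreal \<dots> = (\<Sum>i<N. ennreal (if \<eta> \<in> B i then fv_kernel q N \<xi> i (\<eta> ! i) else 0))"
      by (intro sum_ennreal[symmetric]) (auto simp: B_def intro!: fv_kernel_nonneg[OF q])
    also have "\<dots> = (\<Sum>i<N. if \<eta> \<in> B i then ennreal (fv_kernel q N \<xi> i (\<eta> ! i)) else 0)"
      by (intro sum.cong) auto
    finally show ?thesis .
  qed
  have "(\<integral>\<^sup>+ \<eta>. ennreal (fv_rate q N \<xi> \<eta>) * F \<eta> \<partial>count_space (- {\<xi>}))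
     = (\<Sum>i<N. \<integral>\<^sup>+ \<eta>. (if \<eta> \<in> B i then ennreal (fv_kernel q N \<xi> i (\<eta> ! i)) else 0) * F \<eta>
          \<partial>count_space (- {\<xi>}))"
    unfolding rate sum_distrib_right by (intro nn_integral_sum) auto
  also have "\<dots> = (\<Sum>i<N. \<integral>\<^sup>+ y. ennreal (fv_kernel q N \<xi> i y) * F (\<xi>[i := y]) \<partial>count_space (- {\<xi> ! i}))"
  proof (intro sum.cong refl)
    fix i assume "i \<in> {..<N}"
    then have i: "i < length \<xi>" using \<xi> by simp
    have "(\<integral>\<^sup>+ \<eta>. (if \<eta> \<in> B i then ennreal (fv_kernel q N \<xi> i (\<eta> ! i)) else 0) * F \<eta> \<partial>count_space (- {\<xi>}))
        = (\<integral>\<^sup>+ \<eta>. (if \<eta> \<in> B i then ennreal (fv_kernel q N \<xi> i (\<eta> ! i)) else 0) * F \<eta> \<partial>count_space (B i))"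
      by (intro nn_integral_count_space_eq) (auto simp: B_def)
    also have "\<dots> = (\<integral>\<^sup>+ \<eta>. ennreal (fv_kernel q N \<xi> i (\<eta> ! i)) * F \<eta> \<partial>count_space (B i))"
      by (intro nn_integral_cong) auto
    also have "\<dots> = (\<integral>\<^sup>+ y. ennreal (fv_kernel q N \<xi> i y) * F (\<xi>[i := y]) \<partial>count_space (- {\<xi> ! i}))"
      using i unfolding B_def
      by (subst nn_integral_bij_count_space[OF bij_betw_list_update[OF i], symmetric]) simp
    finally show "(\<integral>\<^sup>+ \<eta>. (if \<eta> \<in> B i then ennreal (fv_kernel q N \<xi> i (\<eta> ! i)) else 0) * F \<eta>
          \<partial>count_space (- {\<xi>})) = \<dots>" .
  qed
  finally show ?thesis .
qed

text \<open>Seen as a function of the site of one particle, \<open>pair_sum\<close> has the form A +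
  B h. Because \<open>h\<close> is bounded and the rates are summable, the two parts can be summed
  separately in the reals over all targets; the target \<open>None\<close>, where \<open>h\<close>
  is 0, contributes A q(x, \<open>None\<close>), which is taken off again. Nonnegativity of A + B h
  brings the result back to \<open>ennreal\<close>.\<close>

lemma integral_rates_affine:
  fixes x :: 'a
  assumes q: "rate_matrix q" and h: "\<And>z. \<bar>h z\<bar> \<le> 1" "h None = 0"
    and nonneg: "\<And>y. 0 \<le> A + B * h (Some y)"
  defines "R \<equiv> A * (exit_rate q (Some x) - q (Some x) None) +
     B * (LINT z|count_space (- {Some x}). q (Some x) z * h z)"
  shows "(\<integral>\<^sup>+ y. ennreal (q (Some x) (Some y)) * ennreal (A + B * h (Some y)) \<partial>count_space (- {x}))
      = ennreal R"
    and "0 \<le> R"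
proof -
  let ?q = "q (Some x)" and ?M = "count_space (- {Some x})"
  let ?k = "\<lambda>z. ?q z * indicator {None} z"
  let ?F = "\<lambda>z. A * ?q z + B * (?q z * h z) - A * ?k z"
  have k: "integrable ?M ?k"
    by (rule Bochner_Integration.integrable_bound[OF rate_matrix_integrable[OF q, of "Some x"]])
       (auto split: split_indicator)
  have qh: "integrable ?M (\<lambda>z. ?q z * h z)"
    using q h(1) by (rule rate_matrix_integrable_mult)
  have "(LINT z|?M. ?k z) = ?q None"
  proof -
    have "finite {z \<in> - {Some x}. ?k z \<noteq> 0}"
      by (rule finite_subset[of _ "{None}"]) (auto split: split_indicator_asm)
    then have "(LINT z|?M. ?k z) = (\<Sum>z | z \<in> - {Some x} \<and> ?k z \<noteq> 0. ?k z)"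
      by (rule lebesgue_integral_count_space_finite_support)
    also have "\<dots> = (\<Sum>z\<in>{None}. ?k z)"
      by (rule sum.mono_neutral_left) (auto split: split_indicator_asm)
    finally show ?thesis by simp
  qed
  moreover have "(LINT z|?M. ?q z) = exit_rate q (Some x)"
  proof -
    have "ennreal (LINT z|?M. ?q z) = ennreal (exit_rate q (Some x))"
      using rate_matrix_integrable[OF q, of "Some x"] rate_matrix_nonneg[OF q, of "Some x"]
      by (subst rate_matrix_nn_integral[OF q, symmetric], subst nn_integral_eq_integral)
         (auto simp: AE_count_space)
    then show ?thesis
      using exit_rate_nonneg[OF q, of "Some x"] rate_matrix_nonneg[OF q, of "Some x"]
      by (subst (asm) ennreal_inj) (auto intro!: Bochner_Integration.integral_nonneg)
  qed
  ultimately have R: "(LINT z|?M. ?F z) = R" and int: "integrable ?M ?F"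
    using k qh rate_matrix_integrable[OF q, of "Some x"]
    by (simp_all add: R_def right_diff_distrib)
  have F: "?F z = (if z = None then 0 else ?q z * (A + B * h z))" for z
    using h(2) by (auto simp: algebra_simps)
  have F_nonneg: "0 \<le> ?F z" if "z \<noteq> Some x" for z
    unfolding F using that rate_matrix_nonneg[OF q, of "Some x" z] nonneg by (cases z) auto
  then show "0 \<le> R"
    unfolding R[symmetric] by (intro Bochner_Integration.integral_nonneg) auto
  have "(\<integral>\<^sup>+ y. ennreal (?q (Some y)) * ennreal (A + B * h (Some y)) \<partial>count_space (- {x}))
      = (\<integral>\<^sup>+ y. ennreal (?F (Some y)) \<partial>count_space (- {x}))"
    using rate_matrix_nonneg[OF q, of "Some x"] nonneg unfolding F
    by (intro nn_integral_cong) (auto simp: ennreal_mult)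
  also have "\<dots> = (\<integral>\<^sup>+ z. ennreal (?F z) \<partial>count_space (Some ` (- {x})))"
    by (rule nn_integral_bij_count_space) (auto simp: bij_betw_def)
  also have "\<dots> = (\<integral>\<^sup>+ z. ennreal (?F z) \<partial>?M)"
  proof (rule nn_integral_count_space_eq)
    show "ennreal (?F z) = 0" if "z \<in> - {Some x} - Some ` (- {x})" for z
      unfolding F using that by (cases z) auto
  qed auto
  also have "\<dots> = ennreal R"
    unfolding R[symmetric] using int F_nonneg by (intro nn_integral_eq_integral) (auto simp: AE_count_space)
  finally show "(\<integral>\<^sup>+ y. ennreal (?q (Some y)) * ennreal (A + B * h (Some y)) \<partial>count_space (- {x}))
      = ennreal R" .
qed

text \<open>The particle count at y is rewritten as a sum over the particles themselves. Moving onto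
  a particle at the same site changes nothing and is not a jump; the condition on sites also
  excludes j = i.\<close>

lemma nn_integral_fv_kernel:
  assumes q: "rate_matrix q"
  shows "(\<integral>\<^sup>+ y. ennreal (fv_kernel q N \<xi> i y) * F y \<partial>count_space (- {\<xi> ! i}))
    = (\<integral>\<^sup>+ y. ennreal (q (Some (\<xi> ! i)) (Some y)) * F y \<partial>count_space (- {\<xi> ! i}))
      + (\<Sum>j | j < N \<and> \<xi> ! j \<noteq> \<xi> ! i. ennreal (q (Some (\<xi> ! i)) None / real (N - 1)) * F (\<xi> ! j))"
proof -
  define c where "c = q (Some (\<xi> ! i)) None / real (N - 1)"
  let ?J = "{j. j < N \<and> \<xi> ! j \<noteq> \<xi> ! i}"
  have c: "0 \<le> c"
    using rate_matrix_nonneg[OF q, of "Some (\<xi> ! i)" None] by (simp add: c_def)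
  have kernel: "ennreal (fv_kernel q N \<xi> i y) = ennreal (q (Some (\<xi> ! i)) (Some y)) +
      (\<Sum>j\<in>?J. ennreal c * indicator {\<xi> ! j} y)" if "y \<noteq> \<xi> ! i" for y
  proof -
    have "{j. j < N \<and> j \<noteq> i \<and> \<xi> ! j = y} = {j \<in> ?J. \<xi> ! j = y}"
      using that by auto
    then have "real (card {j. j < N \<and> j \<noteq> i \<and> \<xi> ! j = y}) = (\<Sum>j\<in>?J. indicator {\<xi> ! j} y)"
      by (simp add: indicator_def sum.If_cases if_distrib Int_def conj_commute eq_commute)
    then have "fv_kernel q N \<xi> i y = q (Some (\<xi> ! i)) (Some y) + (\<Sum>j\<in>?J. c * indicator {\<xi> ! j} y)"
      unfolding fv_kernel_def sum_distrib_left[symmetric] by (simp add: c_def)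
    then show ?thesis
      using c rate_matrix_nonneg[OF q, of "Some (\<xi> ! i)" "Some y"] that
      by (simp add: sum_nonneg ennreal_plus ennreal_mult ennreal_indicator ennreal_of_nat_eq_real_of_nat flip: sum_ennreal)
  qed
  have "(\<integral>\<^sup>+ y. ennreal (fv_kernel q N \<xi> i y) * F y \<partial>count_space (- {\<xi> ! i}))
    = (\<integral>\<^sup>+ y. ennreal (q (Some (\<xi> ! i)) (Some y)) * F y + (\<Sum>j\<in>?J. ennreal c * indicator {\<xi> ! j} y * F y)
        \<partial>count_space (- {\<xi> ! i}))"
    by (intro nn_integral_cong) (simp only: kernel distrib_right sum_distrib_right space_count_space Compl_iff singleton_iff not_False_eq_True)
  also have "\<dots> = (\<integral>\<^sup>+ y. ennreal (q (Some (\<xi> ! i)) (Some y)) * F y \<partial>count_space (- {\<xi> ! i}))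
      + (\<Sum>j\<in>?J. \<integral>\<^sup>+ y. ennreal c * indicator {\<xi> ! j} y * F y \<partial>count_space (- {\<xi> ! i}))"
    by (simp add: nn_integral_add nn_integral_sum)
  also have "(\<Sum>j\<in>?J. \<integral>\<^sup>+ y. ennreal c * indicator {\<xi> ! j} y * F y \<partial>count_space (- {\<xi> ! i}))
      = (\<Sum>j\<in>?J. ennreal c * F (\<xi> ! j))"
  proof (intro sum.cong refl)
    fix j assume j: "j \<in> ?J"
    have "(\<integral>\<^sup>+ y. ennreal c * indicator {\<xi> ! j} y * F y \<partial>count_space (- {\<xi> ! i}))
      = (\<integral>\<^sup>+ y. (ennreal c * F (\<xi> ! j)) * indicator {\<xi> ! j} y \<partial>count_space (- {\<xi> ! i}))"
      by (intro nn_integral_cong) (auto split: split_indicator)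
    also have "\<dots> = ennreal c * F (\<xi> ! j)"
      using j by (subst nn_integral_cmult_indicator) auto
    finally show "(\<integral>\<^sup>+ y. ennreal c * indicator {\<xi> ! j} y * F y \<partial>count_space (- {\<xi> ! i})) = \<dots>" .
  qed
  finally show ?thesis
    unfolding c_def .
qed

lemma fv_rate_nonneg: "rate_matrix q \<Longrightarrow> 0 \<le> fv_rate q N \<xi> \<eta>"
  unfolding fv_rate_def by (intro sum_nonneg) (auto simp: rate_matrix_nonneg)

lemma fv_exit_rate:
  assumes q: "rate_matrix q" and \<xi>: "length \<xi> = N"
  shows "exit_rate (fv_rate q N) \<xi> = (\<Sum>i<N. exit_rate q (Some (\<xi> ! i)) - q (Some (\<xi> ! i)) None
      + real (card {j. j < N \<and> \<xi> ! j \<noteq> \<xi> ! i}) * (q (Some (\<xi> ! i)) None / real (N - 1)))"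
proof -
  define c where "c i = q (Some (\<xi> ! i)) None / real (N - 1)" for i
  let ?E = "\<lambda>i. exit_rate q (Some (\<xi> ! i)) - q (Some (\<xi> ! i)) None
      + real (card {j. j < N \<and> \<xi> ! j \<noteq> \<xi> ! i}) * c i"
  have c: "0 \<le> c i" for i
    using rate_matrix_nonneg[OF q, of "Some (\<xi> ! i)" None] by (simp add: c_def)
  have E: "(\<integral>\<^sup>+ y. ennreal (fv_kernel q N \<xi> i y) \<partial>count_space (- {\<xi> ! i})) = ennreal (?E i)"
    and E0: "0 \<le> ?E i" for i
  proof -
    note rates = integral_rates_affine[OF q, where A = 1 and B = 0 and h = "\<lambda>_. 0" and x = "\<xi> ! i", simplified]
    show "0 \<le> ?E i"
      using rates(2) c[of i] by (intro add_nonneg_nonneg mult_nonneg_nonneg) auto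
    have "(\<Sum>j | j < N \<and> \<xi> ! j \<noteq> \<xi> ! i. ennreal (c i)) = ennreal (real (card {j. j < N \<and> \<xi> ! j \<noteq> \<xi> ! i}) * c i)"
      using c[of i] by (simp add: ennreal_mult ennreal_of_nat_eq_real_of_nat)
    then show "(\<integral>\<^sup>+ y. ennreal (fv_kernel q N \<xi> i y) \<partial>count_space (- {\<xi> ! i})) = ennreal (?E i)"
      using nn_integral_fv_kernel[OF q, where N = N and \<xi> = \<xi> and i = i and F = "\<lambda>_. 1", folded c_def] rates c[of i]
      by (simp add: ennreal_plus)
  qed
  have *: "(\<integral>\<^sup>+ \<eta>. ennreal (fv_rate q N \<xi> \<eta>) \<partial>count_space (- {\<xi>})) = ennreal (\<Sum>i<N. ?E i)"
    using nn_integral_fv_rate[OF q \<xi>, of "\<lambda>_. 1"] E0 by (simp add: E sum_ennreal)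
  \<comment> \<open>\<open>infsum\<close> is 0 on a non-summable family, so finiteness has to
    precede reading off \<open>exit_rate\<close> from this integral.\<close>
  then have fin: "(\<integral>\<^sup>+ \<eta>. ennreal (fv_rate q N \<xi> \<eta>) \<partial>count_space (- {\<xi>})) < \<infinity>"
    by simp
  have "ennreal (exit_rate (fv_rate q N) \<xi>) = ennreal (\<Sum>i<N. ?E i)"
    unfolding exit_rate_def[of "fv_rate q N"] *[symmetric]
    by (intro nn_integral_count_space_eq_infsum[symmetric] summable_on_of_nn_integral_finite fin fv_rate_nonneg[OF q])
  then show ?thesis
    using E0 unfolding c_def by (subst (asm) ennreal_inj)
      (auto simp: exit_rate_def intro!: infsum_nonneg sum_nonneg fv_rate_nonneg[OF q])
qed

section \<open>The functionals S and V and the action of the generator on V\<close>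

definition config_sum :: "('a option \<Rightarrow> real) \<Rightarrow> nat \<Rightarrow> 'a list \<Rightarrow> real" where
  "config_sum h N \<xi> = (\<Sum>i<N. h (Some (\<xi> ! i)))"

text \<open>The sum over ordered pairs i \<noteq> j, written as square minus diagonal so that
  one-particle updates and time derivatives reduce to single sums.\<close>

definition pair_sum :: "('a option \<Rightarrow> real) \<Rightarrow> nat \<Rightarrow> 'a list \<Rightarrow> real" where
  "pair_sum h N \<xi> = (config_sum h N \<xi>)\<^sup>2 - (\<Sum>i<N. (h (Some (\<xi> ! i)))\<^sup>2)"

lemma sum_list_update:
  fixes f :: "'a \<Rightarrow> real"
  assumes "i < N" "length \<xi> = N"
  shows "(\<Sum>j<N. f (\<xi>[i := y] ! j)) = (\<Sum>j<N. f (\<xi> ! j)) + f y - f (\<xi> ! i)"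
proof -
  have "(\<Sum>j\<in>{..<N} - {i}. f (\<xi>[i := y] ! j)) = (\<Sum>j\<in>{..<N} - {i}. f (\<xi> ! j))"
    by (intro sum.cong) auto
  then show ?thesis
    using assms sum.remove[of "{..<N}" i "\<lambda>j. f (\<xi>[i := y] ! j)"] sum.remove[of "{..<N}" i "\<lambda>j. f (\<xi> ! j)"]
    by simp
qed

text \<open>With d the increment of \<open>h\<close> at particle i, the square of
  \<open>config_sum\<close> gains 2 S d + d^2 and the diagonal gains 2 h_i d + d^2. The terms d^2
  cancel, so no squared increment is ever weighted with the jump rates.\<close>

lemma pair_sum_update:
  assumes "i < N" "length \<xi> = N"
  shows "pair_sum h N (\<xi>[i := y]) = pair_sum h N \<xi> +
    2 * (config_sum h N \<xi> - h (Some (\<xi> ! i))) * (h (Some y) - h (Some (\<xi> ! i)))"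
proof -
  have 1: "config_sum h N (\<xi>[i := y]) = config_sum h N \<xi> + h (Some y) - h (Some (\<xi> ! i))"
    unfolding config_sum_def using sum_list_update[OF assms, of "\<lambda>z. h (Some z)" y] .
  have 2: "(\<Sum>j<N. (h (Some (\<xi>[i := y] ! j)))\<^sup>2) =
      (\<Sum>j<N. (h (Some (\<xi> ! j)))\<^sup>2) + (h (Some y))\<^sup>2 - (h (Some (\<xi> ! i)))\<^sup>2"
    using sum_list_update[OF assms, of "\<lambda>z. (h (Some z))\<^sup>2" y] .
  show ?thesis
    unfolding pair_sum_def 1 2 by (simp add: power2_eq_square algebra_simps)
qed

text \<open>2 \<open>D i\<close> is the derivative of V in the value at particle i, and it
  multiplies the drift of that value: \<open>G\<close> from the absorbed chain plus the
  redistribution excess. The diagonal part of the generator stays in the term with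
  \<open>exit_rate\<close>, as required by \<open>backward_step_le\<close>.\<close>

lemma fv_generator_pair_sum:
  assumes q: "rate_matrix q" and N: "N \<ge> 2" and \<xi>: "length \<xi> = N"
    and h: "\<And>z. \<bar>h z\<bar> \<le> 1" "h None = 0"
    and nonneg: "\<And>\<eta>. length \<eta> = N \<Longrightarrow> 0 \<le> a * pair_sum h N \<eta> + c"
  defines "G \<equiv> \<lambda>x. (LINT z|count_space (- {Some x}). q (Some x) z * h z) - exit_rate q (Some x) * h (Some x)"
    and "D \<equiv> \<lambda>i. config_sum h N \<xi> - h (Some (\<xi> ! i))"
  defines "R \<equiv> exit_rate (fv_rate q N) \<xi> * (a * pair_sum h N \<xi> + c) +
      a * (\<Sum>i<N. 2 * D i * (G (\<xi> ! i) + q (Some (\<xi> ! i)) None * D i / real (N - 1)))"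
  shows "(\<integral>\<^sup>+ \<eta>. ennreal (fv_rate q N \<xi> \<eta>) * ennreal (a * pair_sum h N \<eta> + c) \<partial>count_space (- {\<xi>})) = ennreal R"
    and "0 \<le> R"
proof -
  let ?F = "\<lambda>\<eta>. a * pair_sum h N \<eta> + c"
  let ?k = "\<lambda>i. q (Some (\<xi> ! i)) None" and ?l = "\<lambda>i. exit_rate q (Some (\<xi> ! i))"
  let ?h = "\<lambda>i. h (Some (\<xi> ! i))"
  let ?b = "\<lambda>i. LINT z|count_space (- {Some (\<xi> ! i)}). q (Some (\<xi> ! i)) z * h z"
  let ?J = "\<lambda>i. {j. j < N \<and> \<xi> ! j \<noteq> \<xi> ! i}"
  define c' where "c' i = ?k i / real (N - 1)" for i
  \<comment> \<open>Slope and, in the next line, intercept of the functional as an affine function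
    of \<open>h\<close> at the new site of particle i.\<close>
  define B where "B i = 2 * a * D i" for i
  define A where "A i = ?F \<xi> - B i * ?h i" for i
  define T where "T i = A i * (?l i - ?k i) + B i * ?b i +
    (\<Sum>j\<in>?J i. c' i * (A i + B i * ?h j))" for i
  have F: "?F (\<xi>[i := y]) = A i + B i * h (Some y)" if "i < N" for i y
    unfolding A_def B_def D_def pair_sum_update[OF that \<xi>] by (simp add: algebra_simps)
  have AB: "0 \<le> A i + B i * h (Some y)" if "i < N" for i y
    using nonneg[of "\<xi>[i := y]"] \<xi> F[OF that] by simp
  have k0: "0 \<le> c' i" for i
    using rate_matrix_nonneg[OF q, of "Some (\<xi> ! i)" None] by (simp add: c'_def)
  have T: "(\<integral>\<^sup>+ y. ennreal (fv_kernel q N \<xi> i y) * ennreal (?F (\<xi>[i := y])) \<partial>count_space (- {\<xi> ! i})) = ennreal (T i)"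
    and T0: "0 \<le> T i" if i: "i < N" for i
  proof -
    note rates = integral_rates_affine[where A = "A i" and B = "B i" and h = h, OF q h AB[OF i], of "\<xi> ! i"]
    have s0: "0 \<le> (\<Sum>j\<in>?J i. c' i * (A i + B i * ?h j))"
      by (intro sum_nonneg mult_nonneg_nonneg k0 AB i)
    have s: "(\<Sum>j\<in>?J i. ennreal (c' i) * ennreal (A i + B i * ?h j))
       = ennreal (\<Sum>j\<in>?J i. c' i * (A i + B i * ?h j))"
      by (subst sum_ennreal[symmetric])
        (auto intro!: sum.cong mult_nonneg_nonneg ennreal_mult[symmetric] k0 AB i)
    show "0 \<le> T i"
      unfolding T_def using rates(2) s0 by simp
    show "(\<integral>\<^sup>+ y. ennreal (fv_kernel q N \<xi> i y) * ennreal (?F (\<xi>[i := y])) \<partial>count_space (- {\<xi> ! i})) = ennreal (T i)"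
      unfolding nn_integral_fv_kernel[OF q] c'_def[symmetric] F[OF i] s rates(1) T_def
      using rates(2) s0 by (rule ennreal_plus[symmetric])
  qed
  have T_eq: "T i = (?l i - ?k i + real (card (?J i)) * (c' i)) * ?F \<xi> +
      a * (2 * D i * (G (\<xi> ! i) + c' i * D i))" if i: "i < N" for i
  proof -
    have "(\<Sum>j\<in>?J i. A i + B i * ?h j) = (\<Sum>j\<in>?J i. ?F \<xi>) + (\<Sum>j\<in>?J i. B i * (?h j - ?h i))"
      unfolding sum.distrib[symmetric] by (intro sum.cong) (auto simp: A_def algebra_simps)
    also have "(\<Sum>j\<in>?J i. B i * (?h j - ?h i)) = (\<Sum>j<N. B i * (?h j - ?h i))"
      by (intro sum.mono_neutral_left) auto
    also have "\<dots> = B i * (D i - real (N - 1) * ?h i)"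
      using N by (simp add: D_def config_sum_def sum_distrib_left[symmetric] sum_subtractf of_nat_diff algebra_simps)
    finally have "(\<Sum>j\<in>?J i. c' i * (A i + B i * ?h j)) =
        c' i * (real (card (?J i)) * ?F \<xi> + B i * (D i - real (N - 1) * ?h i))"
      by (simp add: sum_distrib_left[symmetric])
    \<comment> \<open>The last term - B k h_i cancels against + B k h_i, which the missing target
      \<open>None\<close> leaves in A i times (exit rate minus k). What remains is the full
      generator \<open>G\<close> of the absorbed chain plus c' D.\<close>
    also have "\<dots> = real (card (?J i)) * (c' i) * ?F \<xi> + B i * (c' i * D i) - B i * (?k i * ?h i)"
    proof -
      have "?k i = c' i * real (N - 1)"
        using N by (simp add: c'_def)
      then show ?thesis
        by (simp only:) (simp add: algebra_simps)
    qed
    finally show ?thesis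
      unfolding T_def G_def A_def B_def by (simp add: algebra_simps)
  qed
  have R: "R = (\<Sum>i<N. T i)"
    unfolding R_def fv_exit_rate[OF q \<xi>] sum_distrib_left sum_distrib_right sum.distrib[symmetric]
    by (intro sum.cong refl) (simp add: T_eq c'_def)
  show "0 \<le> R"
    unfolding R by (intro sum_nonneg T0) auto
  show "(\<integral>\<^sup>+ \<eta>. ennreal (fv_rate q N \<xi> \<eta>) * ennreal (?F \<eta>) \<partial>count_space (- {\<xi>})) = ennreal R"
    unfolding R nn_integral_fv_rate[OF q \<xi>] using T T0 by (subst sum_ennreal[symmetric]) auto
qed

section \<open>The supersolution\<close>

text \<open>This is h_s of the overview, defined on \<open>None\<close> as well so that the
  generator of Z applies to it as it stands. The value at \<open>None\<close> is 0 for s >= 0,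
  because 0 is absorbing and both indicators vanish there.\<close>

definition dev_fun :: "('a option \<Rightarrow> 'a option \<Rightarrow> real) \<Rightarrow> 'a \<Rightarrow> real \<Rightarrow> real \<Rightarrow> 'a option \<Rightarrow> real" where
  "dev_fun q x a s z = enn2real (ctmc_expect q (indicator {Some x}) s z) -
     a * enn2real (ctmc_expect q (indicator (range Some)) s z)"

lemma indicator_le_1_ennreal: "(indicator A z :: ennreal) \<le> 1"
  by (simp split: split_indicator)

lemma ctmc_expect_absorbed:
  fixes q :: "'a::countable option \<Rightarrow> 'a option \<Rightarrow> real"
  assumes "absorbing_zero q" "g None = 0" "0 \<le> t"
  shows "ctmc_expect q g t None = 0"
proof -
  have "ctmc_expect q g t None \<le> (\<lambda>_ _. 0) t None"
    by (rule ctmc_expect_least[where A = "{None}" and T = t])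
       (use assms in \<open>auto simp: absorbing_zero_def backward_step_def\<close>)
  then show ?thesis by simp
qed

text \<open>At t = 0 the integral identity lives on a degenerate interval, so its right-hand side
  must be 0.\<close>

lemma ctmc_expect_0:
  fixes q :: "'s::countable \<Rightarrow> 's \<Rightarrow> real"
  assumes "rate_matrix q" "\<And>y. g y \<le> 1"
  shows "enn2real (ctmc_expect q g 0 x) = enn2real (g x)"
  using has_integral_unique[OF ctmc_expect_has_integral[where t = 0 and x = x, OF assms order_refl,
    unfolded atLeastAtMost_singleton] has_integral_refl(2)] by simp

lemma dev_fun_None:
  fixes q :: "'a::countable option \<Rightarrow> 'a option \<Rightarrow> real"
  shows "absorbing_zero q \<Longrightarrow> 0 \<le> s \<Longrightarrow> dev_fun q x a s None = 0"
  unfolding dev_fun_def by (simp add: ctmc_expect_absorbed)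

lemma dev_fun_0:
  fixes q :: "'a::countable option \<Rightarrow> 'a option \<Rightarrow> real"
  shows "rate_matrix q \<Longrightarrow> dev_fun q x a 0 (Some y) = (if y = x then 1 else 0) - a"
  unfolding dev_fun_def by (simp add: ctmc_expect_0 indicator_le_1_ennreal)

context
  fixes q :: "'a::countable option \<Rightarrow> 'a option \<Rightarrow> real" and a :: real and x :: 'a
  assumes q: "rate_matrix q" and a: "0 \<le> a" "a \<le> 1"
begin

text \<open>Both terms of the difference lie between 0 and the survival probability, which is at
  most 1; for the second one this uses a in [0, 1].\<close>

lemma dev_fun_abs_le_1:
  assumes "0 \<le> s"
  shows "\<bar>dev_fun q x a s z\<bar> \<le> 1"
proof -
  let ?u = "\<lambda>A. enn2real (ctmc_expect q (indicator A) s z)"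
  have le1: "?u (range Some) \<le> 1"
    using ctmc_expect_bounds(2)[OF q indicator_le_1_ennreal assms] .
  have "?u {Some x} \<le> ?u (range Some)"
    using ctmc_expect_bounds(1)[where g = "indicator (range Some)" and x = z, OF q indicator_le_1_ennreal assms]
    by (intro enn2real_mono ctmc_expect_mono) (auto split: split_indicator simp: less_top[symmetric])
  moreover have "a * ?u (range Some) \<le> 1 * ?u (range Some)"
    using a by (intro mult_right_mono) auto
  moreover have "0 \<le> a * ?u (range Some)"
    using a by simp
  ultimately show ?thesis
    using le1 enn2real_nonneg[of "ctmc_expect q (indicator {Some x}) s z"] unfolding dev_fun_def by linarith
qed

lemma dev_fun_has_derivative:
  assumes s: "s \<in> {0..T}"
  shows "((\<lambda>s. dev_fun q x a s y) has_real_derivative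
     (LINT z|count_space (- {y}). q y z * dev_fun q x a s z) - exit_rate q y * dev_fun q x a s y)
     (at s within {0..T})"
proof -
  let ?u = "\<lambda>A s z. enn2real (ctmc_expect q (indicator A) s z)"
  have int: "integrable (count_space (- {y})) (\<lambda>z. q y z * ?u A s z)" for A
    using ctmc_expect_bounds(2)[OF q indicator_le_1_ennreal] s
    by (intro rate_matrix_integrable_mult[OF q]) auto
  have "(LINT z|count_space (- {y}). q y z * dev_fun q x a s z)
      = (LINT z|count_space (- {y}). q y z * ?u {Some x} s z - a * (q y z * ?u (range Some) s z))"
    unfolding dev_fun_def by (simp add: algebra_simps)
  also have "\<dots> = (LINT z|count_space (- {y}). q y z * ?u {Some x} s z)
       - a * (LINT z|count_space (- {y}). q y z * ?u (range Some) s z)"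
    using int by simp
  finally have eq: "(LINT z|count_space (- {y}). q y z * dev_fun q x a s z) = \<dots>" .
  note d = ctmc_expect_has_derivative[OF q indicator_le_1_ennreal s]
  have "((\<lambda>s. ?u {Some x} s y - a * ?u (range Some) s y) has_real_derivative
     ((LINT z|count_space (- {y}). q y z * ?u {Some x} s z) - exit_rate q y * ?u {Some x} s y) -
     a * ((LINT z|count_space (- {y}). q y z * ?u (range Some) s z) - exit_rate q y * ?u (range Some) s y))
     (at s within {0..T})"
    by (intro DERIV_diff DERIV_cmult d)
  then show ?thesis
    unfolding eq by (simp add: dev_fun_def algebra_simps)
qed

end

text \<open>The removed diagonal lies between 0 and N. The first bound makes V + 2N dominate S^2;
  the second bounds V at the initial configuration.\<close>

lemma pair_sum_bounds:
  assumes "\<And>z. \<bar>h z\<bar> \<le> 1"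
  shows "(config_sum h N \<xi>)\<^sup>2 - real N \<le> pair_sum h N \<xi>" "pair_sum h N \<xi> \<le> (config_sum h N \<xi>)\<^sup>2"
proof -
  have "(\<Sum>i<N. (h (Some (\<xi> ! i)))\<^sup>2) \<le> (\<Sum>i<N. 1)"
    using assms by (intro sum_mono) (simp add: abs_square_le_1)
  then show "(config_sum h N \<xi>)\<^sup>2 - real N \<le> pair_sum h N \<xi>"
    by (simp add: pair_sum_def)
  show "pair_sum h N \<xi> \<le> (config_sum h N \<xi>)\<^sup>2"
    by (simp add: pair_sum_def sum_nonneg)
qed

text \<open>The factor in front of \<open>G\<close> is the slope found in
  \<open>pair_sum_update\<close>; this is why the time derivative of V cancels the \<open>G\<close>
  part of the generator exactly.\<close>

lemma pair_sum_has_derivative: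
  assumes "\<And>y. ((\<lambda>s. h s (Some y)) has_real_derivative G y) (at s within S)"
  shows "((\<lambda>s. pair_sum (h s) N \<xi>) has_real_derivative
     (\<Sum>i<N. 2 * (config_sum (h s) N \<xi> - h s (Some (\<xi> ! i))) * G (\<xi> ! i))) (at s within S)"
proof -
  have "((\<lambda>s. pair_sum (h s) N \<xi>) has_real_derivative
     (2 * config_sum (h s) N \<xi> * (\<Sum>i<N. G (\<xi> ! i)) - (\<Sum>i<N. 2 * h s (Some (\<xi> ! i)) * G (\<xi> ! i)))) (at s within S)"
    unfolding pair_sum_def config_sum_def
    by (auto intro!: derivative_eq_intros assms simp: sum_distrib_left algebra_simps)
  then show ?thesis
    by (rule DERIV_cong) (simp add: sum_distrib_left sum_subtractf[symmetric] algebra_simps)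
qed

text \<open>From 1/(N-1) <= 2/N (equality at N = 2) and (S - h)^2 <= 2 S^2 + 2 the sum is at most 8
  C (S^2 + 1). The shift by 2N gives P + 2N >= S^2 + N, which covers this with room to spare: the
  factor 10 is dictated by the exponent 5 C T of the final bound.\<close>

lemma redistribution_bound:
  fixes S C :: real
  assumes "N \<ge> 2" and k: "\<And>i. 0 \<le> k i" "\<And>i. k i \<le> C" and h: "\<And>i. \<bar>h i\<bar> \<le> 1"
    and P: "S\<^sup>2 - real N \<le> P"
  shows "(\<Sum>i<N. 2 * (S - h i) * (k i * (S - h i) / real (N - 1))) \<le> 10 * C * (P + 2 * real N)"
proof -
  have C: "0 \<le> C" using k[of 0] by linarith
  have N: "1 / real (N - 1) \<le> 2 / real N"
    using \<open>N \<ge> 2\<close> by (simp add: field_simps of_nat_diff)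
  have "2 * (S - h i) * (k i * (S - h i) / real (N - 1)) \<le> 2 * (C * (2 * S\<^sup>2 + 2)) * (2 / real N)" for i
  proof -
    have "(h i)\<^sup>2 \<le> 1"
      using h[of i] by (simp add: abs_square_le_1)
    \<comment> \<open>Added to (S - h)^2 this gives 2 S^2 + 2 h^2.\<close>
    moreover have "0 \<le> (S + h i)\<^sup>2" by simp
    ultimately have 1: "(S - h i)\<^sup>2 \<le> 2 * S\<^sup>2 + 2"
      unfolding power2_diff power2_sum by linarith
    have "2 * (S - h i) * (k i * (S - h i) / real (N - 1)) = 2 * (k i * (S - h i)\<^sup>2) * (1 / real (N - 1))"
      by (simp add: power2_eq_square)
    also have "\<dots> \<le> 2 * (C * (2 * S\<^sup>2 + 2)) * (2 / real N)"
      using k 1 N C by (intro mult_mono mult_nonneg_nonneg) auto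
    finally show ?thesis .
  qed
  then have "(\<Sum>i<N. 2 * (S - h i) * (k i * (S - h i) / real (N - 1))) \<le> (\<Sum>i<N. 2 * (C * (2 * S\<^sup>2 + 2)) * (2 / real N))"
    by (intro sum_mono)
  also have "\<dots> = C * (8 * S\<^sup>2 + 8)"
    using \<open>N \<ge> 2\<close> by (simp add: field_simps)
  also have "\<dots> \<le> C * (10 * (P + 2 * real N))"
  proof (rule mult_left_mono[OF _ C])
    have "2 \<le> real N"
      using \<open>N \<ge> 2\<close> by simp
    then have "8 * S\<^sup>2 + 8 \<le> 10 * P + 20 * real N"
      using P zero_le_power2[of S] by linarith
    then show "8 * S\<^sup>2 + 8 \<le> 10 * (P + 2 * real N)"
      by simp
  qed
  finally show ?thesis by (simp only: mult_ac)
qed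

lemma config_sum_dev_fun_0:
  fixes q :: "'a::countable option \<Rightarrow> 'a option \<Rightarrow> real"
  assumes "rate_matrix q" "length \<xi> = N" "N > 0"
  shows "config_sum (dev_fun q x a 0) N \<xi> = real N * (emp \<xi> x - a)"
proof -
  have "{i. i < N \<and> \<xi> ! i = x} = {i \<in> {..<N}. \<xi> ! i = x}" by auto
  then have "real (card {i. i < N \<and> \<xi> ! i = x}) = (\<Sum>i<N. if \<xi> ! i = x then 1 else 0)"
    by (simp add: sum.If_cases Int_def)
  then show ?thesis
    using assms unfolding config_sum_def emp_def
    by (simp add: dev_fun_0 sum_subtractf right_diff_distrib)
qed

text \<open>Young's inequality is built into the supersolution: \<open>W\<close> is the weighted
  quadratic functional plus the constant \<epsilon>/2, so the comparison bounds the first moment in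
  one go. \<epsilon> is left free for the caller to optimise.\<close>

lemma fv_expect_abs_dev_le:
  fixes q :: "'a::countable option \<Rightarrow> 'a option \<Rightarrow> real"
  assumes q: "rate_matrix q" and abs: "absorbing_zero q" and C: "\<And>y. q (Some y) None \<le> C"
    and N: "N \<ge> 2" and \<xi>: "length \<xi> = N" and a: "0 \<le> a" "a \<le> 1" and t: "0 \<le> t" and \<epsilon>: "0 < \<epsilon>"
  shows "ctmc_expect (fv_rate q N) (\<lambda>\<eta>. ennreal \<bar>emp \<eta> x - a\<bar>) t \<xi> \<le>
    ennreal (exp (10 * C * t) * ((config_sum (dev_fun q x a t) N \<xi>)\<^sup>2 + 2 * real N) / (real N)\<^sup>2 / (2 * \<epsilon>) + \<epsilon> / 2)"
proof -
  let ?g = "\<lambda>\<eta>. ennreal \<bar>emp \<eta> x - a\<bar>"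
  define h where "h = dev_fun q x a"
  \<comment> \<open>At time 0, S is N (m(x,\<xi>) - a), so this weight turns S^2 into v^2/(2
    \<epsilon>) with v = m(x,\<xi>) - a.\<close>
  define c where "c = 1 / (2 * \<epsilon> * (real N)\<^sup>2)"
  define A where "A s = c * exp (10 * C * s)" for s
  define W where "W s \<eta> = A s * pair_sum (h s) N \<eta> + (A s * (2 * real N) + \<epsilon> / 2)" for s \<eta>
  have c: "0 < c" using \<epsilon> N by (simp add: c_def)
  then have A: "0 < A s" for s by (simp add: A_def)
  have h1: "\<bar>h s z\<bar> \<le> 1" if "0 \<le> s" for s z
    unfolding h_def using q a that by (rule dev_fun_abs_le_1)
  have W_ge: "A s * (config_sum (h s) N \<eta>)\<^sup>2 + \<epsilon> / 2 \<le> W s \<eta>" if "0 \<le> s" for s \<eta>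
  proof -
    have "A s * (config_sum (h s) N \<eta>)\<^sup>2 \<le> A s * (pair_sum (h s) N \<eta> + 2 * real N)"
      using pair_sum_bounds(1)[where h = "h s", OF h1[OF that], where N = N and \<xi> = \<eta>] A[of s] by (intro mult_left_mono) auto
    then show ?thesis by (simp add: W_def algebra_simps)
  qed
  have W0: "0 \<le> W s \<eta>" if "0 \<le> s" for s \<eta>
    using order.trans[OF _ W_ge[OF that], of 0 \<eta>] A[of s] \<epsilon> by (simp add: less_imp_le)
  have "ctmc_expect (fv_rate q N) ?g t \<xi> \<le> ennreal (W t \<xi>)"
  proof (rule ctmc_expect_least[where A = "{\<eta>. length \<eta> = N}" and T = t and u = "\<lambda>s \<eta>. ennreal (W s \<eta>)"])
    show "fv_rate q N \<eta> \<zeta> = 0" if "\<eta> \<in> {\<eta>. length \<eta> = N}" "\<zeta> \<notin> {\<eta>. length \<eta> = N}" for \<eta> \<zeta> :: "'a list"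
      using that by (simp add: fv_rate_closed)
  next
    fix t :: real and \<eta> :: "'a list" assume t: "0 \<le> t" and "\<eta> \<in> {\<eta>. length \<eta> = N}"
    then have \<eta>: "length \<eta> = N" by simp
    define G where "G s y = (LINT z|count_space (- {Some y}). q (Some y) z * h s z) -
      exit_rate q (Some y) * h s (Some y)" for s :: real and y
    define S where "S s = config_sum (h s) N \<eta>" for s :: real
    define D where "D s = A s * (10 * C * (pair_sum (h s) N \<eta> + 2 * real N) +
      (\<Sum>i<N. 2 * (S s - h s (Some (\<eta> ! i))) * G s (\<eta> ! i)))" for s :: real
    have deriv: "((\<lambda>s. W s \<eta>) has_real_derivative D s) (at s within {0..t})" if "s \<in> {0..t}" for s :: real
    proof -
      have "((\<lambda>s. h s (Some y)) has_real_derivative G s y) (at s within {0..t})" for y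
        unfolding h_def G_def using q a that by (rule dev_fun_has_derivative)
      from pair_sum_has_derivative[where h = h and G = "G s" and N = N and \<xi> = \<eta>, OF this] show ?thesis
        unfolding W_def A_def D_def S_def
        by (auto intro!: derivative_eq_intros simp: algebra_simps)
    qed
    have gen: "(\<integral>\<^sup>+ \<zeta>. ennreal (fv_rate q N \<eta> \<zeta>) * ennreal (W s \<zeta>) \<partial>count_space (- {\<eta>}))
        \<le> ennreal (D s + exit_rate (fv_rate q N) \<eta> * W s \<eta>)"
      and nonneg: "0 \<le> D s + exit_rate (fv_rate q N) \<eta> * W s \<eta>" if s: "s \<in> {0..t}" for s
    proof -
      have s0: "0 \<le> s" using s by simp
      let ?d = "\<lambda>i. S s - h s (Some (\<eta> ! i))"
      define R where "R = exit_rate (fv_rate q N) \<eta> * W s \<eta> +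
        A s * (\<Sum>i<N. 2 * ?d i * (G s (\<eta> ! i) + q (Some (\<eta> ! i)) None * ?d i / real (N - 1)))"
      have hN: "h s None = 0"
        unfolding h_def using dev_fun_None[OF abs s0] .
      have pos: "0 \<le> A s * pair_sum (h s) N \<zeta> + (A s * (2 * real N) + \<epsilon> / 2)" for \<zeta>
        using W0[OF s0, of \<zeta>] by (simp add: W_def)
      have R: "(\<integral>\<^sup>+ \<zeta>. ennreal (fv_rate q N \<eta> \<zeta>) * ennreal (W s \<zeta>) \<partial>count_space (- {\<eta>})) = ennreal R"
        "0 \<le> R"
        using fv_generator_pair_sum[OF q N \<eta> h1[OF s0] hN pos] unfolding R_def W_def G_def S_def .
      \<comment> \<open>The terms with \<open>G\<close> occur identically in \<open>R\<close> and in
        \<open>D s\<close>; what is left to compare is the redistribution sum and the growth of the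
        exponential factor.\<close>
      have "(\<Sum>i<N. 2 * ?d i * (q (Some (\<eta> ! i)) None * ?d i / real (N - 1)))
          \<le> 10 * C * (pair_sum (h s) N \<eta> + 2 * real N)"
        using N C rate_matrix_nonneg[OF q, of "Some _" None] h1[OF s0] pair_sum_bounds(1)[where h = "h s", OF h1[OF s0]]
        unfolding S_def by (intro redistribution_bound) auto
      from mult_left_mono[OF this less_imp_le[OF A[of s]]]
      have "R \<le> D s + exit_rate (fv_rate q N) \<eta> * W s \<eta>"
        unfolding R_def D_def by (simp add: distrib_left sum.distrib)
      with R show "0 \<le> D s + exit_rate (fv_rate q N) \<eta> * W s \<eta>"
        "(\<integral>\<^sup>+ \<zeta>. ennreal (fv_rate q N \<eta> \<zeta>) * ennreal (W s \<zeta>) \<partial>count_space (- {\<eta>}))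
        \<le> ennreal (D s + exit_rate (fv_rate q N) \<eta> * W s \<eta>)"
        by (auto intro: ennreal_leI)
    qed
    have init: "\<bar>emp \<eta> x - a\<bar> \<le> W 0 \<eta>"
    proof -
      let ?v = "\<bar>emp \<eta> x - a\<bar>"
      have "0 \<le> (?v - \<epsilon>)\<^sup>2" by simp
      then have "?v * (2 * \<epsilon>) \<le> ?v\<^sup>2 + \<epsilon>\<^sup>2"
        by (simp add: power2_diff algebra_simps)
      then have "?v \<le> (?v\<^sup>2 + \<epsilon>\<^sup>2) / (2 * \<epsilon>)"
        using \<epsilon> by (subst pos_le_divide_eq) auto
      also have "\<dots> = A 0 * (config_sum (h 0) N \<eta>)\<^sup>2 + \<epsilon> / 2"
        using N \<epsilon> unfolding h_def config_sum_dev_fun_0[OF q \<eta> order.strict_trans2[OF pos2 N]]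
        by (simp add: A_def c_def field_simps power2_eq_square)
      also have "\<dots> \<le> W 0 \<eta>"
        by (rule W_ge) simp
      finally show ?thesis .
    qed
    show "backward_step (fv_rate q N) ?g (\<lambda>s \<eta>. ennreal (W s \<eta>)) t \<eta> \<le> ennreal (W t \<eta>)"
      using t deriv nonneg gen ennreal_leI[OF init] W0[of 0 \<eta>] by (rule backward_step_le) auto
  qed (use t \<xi> in auto)
  also have "W t \<xi> \<le> A t * ((config_sum (h t) N \<xi>)\<^sup>2 + 2 * real N) + \<epsilon> / 2"
    using pair_sum_bounds(2)[where h = "h t", OF h1[OF t], where N = N and \<xi> = \<xi>] A[of t]
    by (simp add: W_def distrib_left)
  also have "\<dots> = exp (10 * C * t) * ((config_sum (h t) N \<xi>)\<^sup>2 + 2 * real N) / (real N)\<^sup>2 / (2 * \<epsilon>) + \<epsilon> / 2"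
    by (simp add: A_def c_def)
  finally show ?thesis
    unfolding h_def by (simp add: ennreal_leI)
qed

section \<open>The conditioned evolution expressed through the killed semigroup\<close>

lemma ctmc_trans_eq_expect:
  "ctmc_trans q t z y = ctmc_expect q (indicator {y}) t z"
  unfolding ctmc_expect_def by (simp add: nn_integral_count_space_indicator[symmetric])

lemma nn_integral_ctmc_trans_Some:
  "(\<integral>\<^sup>+ y. ctmc_trans q t z (Some y) \<partial>count_space UNIV) = ctmc_expect q (indicator (range Some)) t z"
proof -
  have "(\<integral>\<^sup>+ y. ctmc_trans q t z (Some y) \<partial>count_space UNIV)
      = (\<integral>\<^sup>+ y. ctmc_trans q t z y \<partial>count_space (range Some))"
    by (rule nn_integral_bij_count_space) (auto simp: bij_betw_def)
  also have "\<dots> = ctmc_expect q (indicator (range Some)) t z"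
    unfolding ctmc_expect_def by (rule nn_integral_count_space_indicator) simp
  finally show ?thesis .
qed

context
  fixes q :: "'a::countable option \<Rightarrow> 'a option \<Rightarrow> real" and \<mu> :: "'a \<Rightarrow> real" and t :: real
  assumes q: "rate_matrix q" and \<mu>: "prob_fun \<mu>" and t: "0 \<le> t"
begin

lemma prob_fun_mult_summable:
  assumes "\<And>z. \<bar>f z\<bar> \<le> 1"
  shows "(\<lambda>z. \<mu> z * f z) summable_on UNIV"
proof -
  have "integrable (count_space UNIV) \<mu>"
    using \<mu> unfolding prob_fun_def summable_on_real_iff_integrable[symmetric]
    by (auto intro: has_sum_imp_summable)
  then show ?thesis
    unfolding summable_on_real_iff_integrable
    by (rule Bochner_Integration.integrable_bound) (use assms in \<open>auto simp: abs_mult intro!: mult_left_le\<close>)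
qed

text \<open>Tonelli: summing over the target first yields the survival probability of each starting
  point. The identity is proved in \<open>ennreal\<close>, where it gives summability of the law
  together with its total mass.\<close>

lemma law_at_summable: "law_at q \<mu> t summable_on UNIV"
  and infsum_law_at: "(\<Sum>\<^sub>\<infinity> y. law_at q \<mu> t y) =
     (\<Sum>\<^sub>\<infinity> z. \<mu> z * enn2real (ctmc_expect q (indicator (range Some)) t (Some z)))"
  and law_at_nonneg: "0 \<le> law_at q \<mu> t y"
proof -
  have \<mu>0: "0 \<le> \<mu> z" for z
    using \<mu> by (simp add: prob_fun_def)
  let ?u = "\<lambda>A z. enn2real (ctmc_expect q (indicator A) t (Some z))"
  have E: "ctmc_expect q (indicator A) t (Some z) = ennreal (?u A z)" "?u A z \<le> 1" for A z
    using ctmc_expect_bounds[OF q indicator_le_1_ennreal t] .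
  have law: "law_at q \<mu> t y = (\<Sum>\<^sub>\<infinity> z. \<mu> z * ?u {Some y} z)" for y
    unfolding law_at_def ctmc_trans_eq_expect ..
  have sum: "(\<lambda>z. \<mu> z * ?u A z) summable_on UNIV" for A
    using E(2) by (intro prob_fun_mult_summable) auto
  show law0: "0 \<le> law_at q \<mu> t y" for y
    unfolding law using \<mu>0 by (intro infsum_nonneg) auto
  have enn: "ennreal (\<Sum>\<^sub>\<infinity> z. \<mu> z * ?u A z) =
      (\<integral>\<^sup>+ z. ennreal (\<mu> z) * ctmc_expect q (indicator A) t (Some z) \<partial>count_space UNIV)" for A
  proof -
    have "ennreal (\<mu> z * ?u A z) = ennreal (\<mu> z) * ctmc_expect q (indicator A) t (Some z)" for z
      using \<mu>0 E(1)[of A z, symmetric] by (simp add: ennreal_mult)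
    then show ?thesis
      using nn_integral_count_space_eq_infsum[OF sum[of A]] \<mu>0 by simp
  qed
  have "(\<integral>\<^sup>+ y. ennreal (law_at q \<mu> t y) \<partial>count_space UNIV) =
      (\<integral>\<^sup>+ y. \<integral>\<^sup>+ z. ennreal (\<mu> z) * ctmc_trans q t (Some z) (Some y) \<partial>count_space UNIV \<partial>count_space UNIV)"
    unfolding law enn ctmc_trans_eq_expect ..
  also have "\<dots> = (\<integral>\<^sup>+ z. \<integral>\<^sup>+ y. ennreal (\<mu> z) * ctmc_trans q t (Some z) (Some y) \<partial>count_space UNIV \<partial>count_space UNIV)"
    by (intro nn_integral_count_space_nn_integral) auto
  also have "\<dots> = ennreal (\<Sum>\<^sub>\<infinity> z. \<mu> z * ?u (range Some) z)"
    unfolding enn by (simp add: nn_integral_cmult nn_integral_ctmc_trans_Some)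
  finally have *: "(\<integral>\<^sup>+ y. ennreal (law_at q \<mu> t y) \<partial>count_space UNIV) = \<dots>" .
  show summable: "law_at q \<mu> t summable_on UNIV"
    by (rule summable_on_of_nn_integral_finite) (auto simp: * law0)
  have "ennreal (\<Sum>\<^sub>\<infinity> y. law_at q \<mu> t y) = ennreal (\<Sum>\<^sub>\<infinity> z. \<mu> z * ?u (range Some) z)"
    unfolding *[symmetric] by (rule nn_integral_count_space_eq_infsum[symmetric, OF summable law0])
  then show "(\<Sum>\<^sub>\<infinity> y. law_at q \<mu> t y) = (\<Sum>\<^sub>\<infinity> z. \<mu> z * ?u (range Some) z)"
    using law0 \<mu>0 by (subst (asm) ennreal_inj) (auto intro!: infsum_nonneg)
qed

lemma law_at_le_infsum: "law_at q \<mu> t x \<le> (\<Sum>\<^sub>\<infinity> y. law_at q \<mu> t y)"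
proof -
  have "infsum (law_at q \<mu> t) {x} \<le> infsum (law_at q \<mu> t) UNIV"
    using law_at_summable law_at_nonneg by (intro infsum_mono_neutral) auto
  then show ?thesis by simp
qed

lemma infsum_law_at_nonneg: "0 \<le> (\<Sum>\<^sub>\<infinity> y. law_at q \<mu> t y)"
  by (intro infsum_nonneg law_at_nonneg)

lemma cond_evol_nonneg: "0 \<le> cond_evol q \<mu> t x"
  unfolding cond_evol_def by (intro divide_nonneg_nonneg law_at_nonneg infsum_law_at_nonneg)

lemma cond_evol_le_1: "cond_evol q \<mu> t x \<le> 1"
  unfolding cond_evol_def using law_at_le_infsum[of x] infsum_law_at_nonneg
  by (auto simp only: divide_le_eq_1 order_less_le)

text \<open>The constant cond_evol q \<mu> t x centres the test function under \<mu>, so that only the initial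
  discrepancy between \<mu> and m(\<xi>0) is left. If the surviving mass is 0, then cond_evol is 0 by
  division by zero, and the identity still holds.\<close>
lemma infsum_dev_fun_cond_evol: "(\<Sum>\<^sub>\<infinity> z. \<mu> z * dev_fun q x (cond_evol q \<mu> t x) t (Some z)) = 0"
proof -
  let ?a = "cond_evol q \<mu> t x" and ?M = "\<Sum>\<^sub>\<infinity> y. law_at q \<mu> t y"
  let ?u = "\<lambda>A z. enn2real (ctmc_expect q (indicator A) t (Some z))"
  have sum: "(\<lambda>z. \<mu> z * ?u A z) summable_on UNIV" for A
    using ctmc_expect_bounds(2)[OF q indicator_le_1_ennreal t] by (intro prob_fun_mult_summable) auto
  have "law_at q \<mu> t x = (\<Sum>\<^sub>\<infinity> z. \<mu> z * dev_fun q x ?a t (Some z) + ?a * (\<mu> z * ?u (range Some) z))"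
    unfolding law_at_def ctmc_trans_eq_expect by (simp add: dev_fun_def algebra_simps)
  also have "\<dots> = (\<Sum>\<^sub>\<infinity> z. \<mu> z * dev_fun q x ?a t (Some z)) + (\<Sum>\<^sub>\<infinity> z. ?a * (\<mu> z * ?u (range Some) z))"
    by (intro infsum_add summable_on_cmult_right sum prob_fun_mult_summable
        dev_fun_abs_le_1[OF q cond_evol_nonneg cond_evol_le_1 t])
  also have "(\<Sum>\<^sub>\<infinity> z. ?a * (\<mu> z * ?u (range Some) z)) = ?a * ?M"
    unfolding infsum_law_at by (simp add: infsum_cmult_right sum)
  finally have "(\<Sum>\<^sub>\<infinity> z. \<mu> z * dev_fun q x ?a t (Some z)) = law_at q \<mu> t x - ?a * ?M"
    by linarith
  also have "\<dots> = 0"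
    using law_at_le_infsum[of x] law_at_nonneg[of x] by (cases "?M = 0") (auto simp: cond_evol_def)
  finally show ?thesis .
qed

end

section \<open>Initial discrepancy and final estimate\<close>

lemma infsum_emp_mult:
  assumes "length \<xi> = N"
  shows "(\<lambda>y. emp \<xi> y * f y) summable_on UNIV"
    and "(\<Sum>\<^sub>\<infinity> y. emp \<xi> y * f y) = (\<Sum>i<N. f (\<xi> ! i)) / real N"
proof -
  have zero: "emp \<xi> y = 0" if "y \<notin> set \<xi>" for y
    using that by (auto simp: emp_def in_set_conv_nth)
  have "(\<lambda>y. emp \<xi> y * f y) summable_on UNIV \<longleftrightarrow> (\<lambda>y. emp \<xi> y * f y) summable_on set \<xi>"
    by (rule summable_on_cong_neutral) (auto simp: zero)
  then show "(\<lambda>y. emp \<xi> y * f y) summable_on UNIV"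
    by simp
  have "(\<Sum>\<^sub>\<infinity> y. emp \<xi> y * f y) = (\<Sum>\<^sub>\<infinity> y\<in>set \<xi>. emp \<xi> y * f y)"
    by (rule infsum_cong_neutral) (auto simp: zero)
  \<comment> \<open>Particles are grouped by site: each occupied site y contributes f(y) once for
    every particle there.\<close>
  also have "\<dots> = (\<Sum>y\<in>set \<xi>. (\<Sum>i\<in>{i \<in> {..<N}. \<xi> ! i = y}. f (\<xi> ! i))) / real N"
    using assms by (simp add: emp_def sum_divide_distrib)
  also have "(\<Sum>y\<in>set \<xi>. (\<Sum>i\<in>{i \<in> {..<N}. \<xi> ! i = y}. f (\<xi> ! i))) = (\<Sum>i<N. f (\<xi> ! i))"
    using assms by (intro sum.group) auto
  finally show "(\<Sum>\<^sub>\<infinity> y. emp \<xi> y * f y) = (\<Sum>i<N. f (\<xi> ! i)) / real N" .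
qed

text \<open>As \<open>f\<close> has \<mu>-mean 0, its mean over the particles equals its integral
  against m(\<xi>) - \<mu>, and |f| <= 1. \<open>tv_norm\<close> is the full l1 norm, so no factor 2
  appears.\<close>

lemma abs_config_mean_le_tv_norm:
  assumes \<mu>: "prob_fun \<mu>" and \<xi>: "length \<xi> = N" and f: "\<And>y. \<bar>f y\<bar> \<le> 1"
    and centred: "(\<Sum>\<^sub>\<infinity> y. \<mu> y * f y) = 0"
  shows "\<bar>(\<Sum>i<N. f (\<xi> ! i)) / real N\<bar> \<le> tv_norm \<mu> (emp \<xi>)"
proof -
  have d: "(\<lambda>y. \<mu> y - emp \<xi> y) summable_on UNIV"
  proof -
    have "\<mu> summable_on UNIV" "emp \<xi> summable_on UNIV"
      using \<mu> infsum_emp_mult(1)[OF \<xi>, of "\<lambda>_. 1"]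
      by (auto simp: prob_fun_def intro: has_sum_imp_summable)
    then show ?thesis
      unfolding summable_on_real_iff_integrable by (rule Bochner_Integration.integrable_diff)
  qed
  then have abs_d: "(\<lambda>y. \<bar>\<mu> y - emp \<xi> y\<bar>) summable_on UNIV"
    using summable_on_iff_abs_summable_on_real[of "\<lambda>y. \<mu> y - emp \<xi> y" UNIV] by simp
  have df: "(\<lambda>y. (\<mu> y - emp \<xi> y) * f y) summable_on UNIV"
    using d unfolding summable_on_real_iff_integrable
    by (rule Bochner_Integration.integrable_bound) (auto simp: abs_mult f intro!: mult_left_le)
  then have abs_df: "(\<lambda>y. \<bar>(\<mu> y - emp \<xi> y) * f y\<bar>) summable_on UNIV"
    using summable_on_iff_abs_summable_on_real[of "\<lambda>y. (\<mu> y - emp \<xi> y) * f y" UNIV] by simp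
  have "(\<Sum>\<^sub>\<infinity> y. \<mu> y * f y) = (\<Sum>\<^sub>\<infinity> y. (\<mu> y - emp \<xi> y) * f y + emp \<xi> y * f y)"
    by (simp add: algebra_simps)
  also have "\<dots> = (\<Sum>\<^sub>\<infinity> y. (\<mu> y - emp \<xi> y) * f y) + (\<Sum>\<^sub>\<infinity> y. emp \<xi> y * f y)"
    by (intro infsum_add df infsum_emp_mult(1)[OF \<xi>])
  finally have "\<bar>(\<Sum>i<N. f (\<xi> ! i)) / real N\<bar> = \<bar>\<Sum>\<^sub>\<infinity> y. (\<mu> y - emp \<xi> y) * f y\<bar>"
    unfolding centred infsum_emp_mult(2)[OF \<xi>] by linarith
  also have "\<dots> \<le> (\<Sum>\<^sub>\<infinity> y. \<bar>(\<mu> y - emp \<xi> y) * f y\<bar>)"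
    using norm_infsum_bound[of "\<lambda>y. (\<mu> y - emp \<xi> y) * f y" UNIV] abs_df by simp
  also have "\<dots> \<le> tv_norm \<mu> (emp \<xi>)"
    unfolding tv_norm_def
    by (intro infsum_mono abs_df abs_d) (auto simp: abs_mult f intro!: mult_left_le)
  finally show ?thesis .
qed

text \<open>Under the root, (S/N)^2 + 2/N is at most d^2 + 9/N, and the nonnegative cross term
  completes the square of 3/sqrt N + d. Since C >= 0, the exponential at t is at most the one at
  T.\<close>

lemma sqrt_horizon_bound:
  fixes C S d t T :: real
  assumes "\<bar>S / real N\<bar> \<le> d" "t \<le> T" "0 \<le> C" "0 < N"
  shows "sqrt (exp (10 * C * t) * (S\<^sup>2 + 2 * real N) / (real N)\<^sup>2) \<le> exp (5 * C * T) * (3 / sqrt (real N) + d)"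
proof -
  have d: "0 \<le> d" using assms(1) by linarith
  have "(S / real N)\<^sup>2 \<le> d\<^sup>2"
    using assms(1) by (intro power2_le_iff_abs_le[THEN iffD2] d)
  moreover have "(S\<^sup>2 + 2 * real N) / (real N)\<^sup>2 = (S / real N)\<^sup>2 + 2 / real N"
    using assms(4) by (simp add: field_simps power2_eq_square)
  moreover have "2 / real N \<le> (3 / sqrt (real N))\<^sup>2"
    by (simp add: power_divide divide_right_mono)
  moreover have "(3 / sqrt (real N))\<^sup>2 + d\<^sup>2 \<le> (3 / sqrt (real N) + d)\<^sup>2"
    using d by (simp add: power2_sum)
  ultimately have "(S\<^sup>2 + 2 * real N) / (real N)\<^sup>2 \<le> (3 / sqrt (real N) + d)\<^sup>2"
    by linarith
  moreover have "exp (10 * C * t) \<le> (exp (5 * C * T))\<^sup>2"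
    using assms(2,3) by (simp add: exp_double[symmetric] mult_left_mono)
  ultimately have "exp (10 * C * t) * ((S\<^sup>2 + 2 * real N) / (real N)\<^sup>2) \<le> (exp (5 * C * T) * (3 / sqrt (real N) + d))\<^sup>2"
    unfolding power_mult_distrib by (intro mult_mono) auto
  then show ?thesis
    using d by (intro real_le_lsqrt) auto
qed

theorem theorem2:
  fixes q :: "'a::countable option \<Rightarrow> 'a option \<Rightarrow> real"
    and C T :: real and \<mu> :: "'a \<Rightarrow> real" and N :: nat and \<xi>0 :: "'a list" and x :: 'a
  assumes "rate_matrix q"
    and "non_exploding q"
    and "irreducible_on_Lambda q"
    and "absorbing_zero q"
    and "certain_absorption q"
    and "\<forall>w. (\<lambda>y. q (Some y) w) summable_on UNIV \<and> (\<Sum>\<^sub>\<infinity> y. q (Some y) w) \<le> C"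
    and "prob_fun \<mu>"
    and "(\<integral>\<^sup>+ z. ennreal (- \<mu> z * q (Some z) (Some z)) \<partial>count_space UNIV) < \<infinity>"
    and "N \<ge> 2"
    and "length \<xi>0 = N"
    and "T > 0"
  shows "(SUP t \<in> {0..T}. fv_abs_dev q N \<xi>0 t x (cond_evol q \<mu> t x))
           \<le> ennreal (exp (5 * C * T) * (3 / sqrt (real N) + tv_norm \<mu> (emp \<xi>0)))"
proof (rule SUP_least)
  fix t assume "t \<in> {0..T}"
  then have t: "0 \<le> t" "t \<le> T" by auto
  note q = assms(1) and abs = assms(4) and \<mu> = assms(7) and N = assms(9) and \<xi>0 = assms(10)
  have \<kappa>0: "0 \<le> q (Some y) None" for y
    using rate_matrix_nonneg[OF q] by simp
  \<comment> \<open>All entries in the column of \<open>None\<close> are off-diagonal, hence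
    nonnegative, so each is bounded by the column sum.\<close>
  have \<kappa>: "q (Some y) None \<le> C" for y
  proof -
    have "infsum (\<lambda>y. q (Some y) None) {y} \<le> infsum (\<lambda>y. q (Some y) None) UNIV"
      using assms(6) \<kappa>0 by (intro infsum_mono_neutral) auto
    then show ?thesis
      using assms(6)[rule_format, of None] by simp
  qed
  have C: "0 \<le> C"
    using \<kappa>0 \<kappa> by (rule order.trans)
  define a where "a = cond_evol q \<mu> t x"
  have a: "0 \<le> a" "a \<le> 1"
    unfolding a_def using cond_evol_nonneg[OF q \<mu> t(1)] cond_evol_le_1[OF q \<mu> t(1)] by auto
  define S where "S = config_sum (dev_fun q x a t) N \<xi>0"
  \<comment> \<open>The minimiser of K/(2 \<epsilon>) + \<epsilon>/2 is \<epsilon> = sqrt K, and the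
    minimum is again sqrt K.\<close>
  define \<epsilon> where "\<epsilon> = sqrt (exp (10 * C * t) * (S\<^sup>2 + 2 * real N) / (real N)\<^sup>2)"
  \<comment> \<open>The summand 2N keeps K positive even when S = 0, so dividing by \<epsilon> is
    legitimate.\<close>
  have pos: "0 < exp (10 * C * t) * (S\<^sup>2 + 2 * real N) / (real N)\<^sup>2"
    using N by (intro divide_pos_pos mult_pos_pos add_nonneg_pos) auto
  then have \<epsilon>: "0 < \<epsilon>" "exp (10 * C * t) * (S\<^sup>2 + 2 * real N) / (real N)\<^sup>2 = \<epsilon> * \<epsilon>"
    unfolding \<epsilon>_def by simp_all
  have "fv_abs_dev q N \<xi>0 t x a \<le> ennreal (\<epsilon> * \<epsilon> / (2 * \<epsilon>) + \<epsilon> / 2)"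
    using fv_expect_abs_dev_le[OF q abs \<kappa> N \<xi>0 a t(1) \<epsilon>(1), of x]
    unfolding S_def[symmetric] \<epsilon>(2) by (simp only: fv_abs_dev_def ctmc_expect_def)
  also have "\<epsilon> * \<epsilon> / (2 * \<epsilon>) + \<epsilon> / 2 = \<epsilon>"
    using \<epsilon>(1) by simp
  also have "\<bar>S / real N\<bar> \<le> tv_norm \<mu> (emp \<xi>0)"
    unfolding S_def config_sum_def
    by (rule abs_config_mean_le_tv_norm[OF \<mu> \<xi>0 dev_fun_abs_le_1[OF q a t(1)]])
       (simp add: a_def infsum_dev_fun_cond_evol[OF q \<mu> t(1)])
  then have "\<epsilon> \<le> exp (5 * C * T) * (3 / sqrt (real N) + tv_norm \<mu> (emp \<xi>0))"
    unfolding \<epsilon>_def using t(2) C N by (intro sqrt_horizon_bound) auto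
  finally show "fv_abs_dev q N \<xi>0 t x (cond_evol q \<mu> t x)
      \<le> ennreal (exp (5 * C * T) * (3 / sqrt (real N) + tv_norm \<mu> (emp \<xi>0)))"
    by (simp add: a_def ennreal_leI)
qed

end
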